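(* Let $k$ be a field of characteristic $0$ or $p>13$, and $\overline{k}$ a fixed separable closure. For the following subgroups $H$ of $\operatorname{PGL}_3(\overline{k})$, the normalizer $N_H(\overline{k})$ of $H$ in $\operatorname{PGL}_3(\overline{k})$ is as stated: \begin{itemize} \item $H=\{1\}$: $N_H(\overline{k})=\operatorname{PGL}_3(\overline{k})$; \item $H=\langle[X:Y:-Z]\rangle\cong\mathbb{Z}/2\mathbb{Z}$: $N_H(\overline{k})=\operatorname{GL}_{2,Z}(\overline{k})$; \item $H=\langle[X:\zeta_3Y:\zeta_3^2Z]\rangle\cong\mathbb{Z}/3\mathbb{Z}$: $N_H(\overline{k})=\langle D(\overline{k}),\tilde S_3\rangle$; \item $H=\langle[X:Y:\zeta_4Z]\rangle\cong\mathbb{Z}/4\mathbb{Z}$: $N_H(\overline{k})=\operatorname{GL}_{2,Z}(\overline{k})$; \item $H=\langle[X:\zeta_4Y:\zeta_4^2Z]\rangle\cong\mathbb{Z}/4\mathbb{Z}$: $N_H(\overline{k})=\langle D(\overline{k}),[Z:Y:X]\rangle$; \item $H=\langle[X:Y:\zeta_5Z]\rangle\cong\mathbb{Z}/5\mathbb{Z}$: $N_H(\overline{k})=\operatorname{GL}_{2,Z}(\overline{k})$; \item $H=\langle[X:\zeta_3Y:\zeta_3^2Z],[X:Z:Y]\rangle\cong S_3$: $N_H(\overline{k})=\langle T_X(\overline{k}),G_{03}\rangle$; \item $H=\langle[X:\zeta_8Y:\zeta_8^4Z]\rangle\cong\mathbb{Z}/8\mathbb{Z}$: $N_H(\overline{k})=\langle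 D(\overline{k}),[Z:Y:X]\rangle$; \item $H=\langle[X:\zeta_5Y:\zeta_5^4Z],[X:Z:Y]\rangle\cong D_{10}$: $N_H(\overline{k})=\langle T_X(\overline{k}),G_{05}\rangle$; \item $H=\langle[X:\zeta_{10}^2Y:\zeta_{10}^5Z]\rangle\cong\mathbb{Z}/10\mathbb{Z}$: $N_H(\overline{k})=D(\overline{k})$. \end{itemize}
   Context: $\zeta_n$ denotes a primitive $n$-th root of unity in $\overline{k}$. A symbol $[L_1:L_2:L_3]$ with linear forms $L_i$ in $X,Y,Z$ denotes the element of $\operatorname{PGL}_3(\overline{k})$ sending $(X:Y:Z)$ to $(L_1:L_2:L_3)$. $D(\overline{k})$ is the subgroup of diagonal elements of $\operatorname{PGL}_3(\overline{k})$; $T_X(\overline{k})=\{[aX:Y:Z]: a\in\overline{k}^*\}$. $\operatorname{GL}_{2,Z}(\overline{k})$ is the subgroup of $\operatorname{PGL}_3(\overline{k})$ consisting of classes of block matrices acting by an invertible $2\times 2$ matrix on the variables $X,Y$ and fixing $Z$, i.e. of the form $[\alpha X+\beta Y:\gamma X+\delta Y:Z]$. $\tilde S_3=\langle[X:Z:Y],[Z:X:Y]\rangle$, $G_{03}=\langle[X:Z:Y],[X:\zeta_3Y:Z]\rangle$, $G_{05}=\langle[X:Z:Y],[X:Y:\zeta_5Z]\rangle$. *)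

theory Defs
  imports
    "HOL-Analysis.Cartesian_Space"
    "HOL-Computational_Algebra.Polynomial_Factorial"
    "HOL-Algebra.Group_Action"
    "HOL-Algebra.Elementary_Groups"
    "HOL-Algebra.Sym_Groups"
begin

definition separable_poly :: "'a::field poly \<Rightarrow> bool" where
  "separable_poly p \<longleftrightarrow> coprime p (pderiv p)"

definition field_embedding :: "('k::field \<Rightarrow> 'a::field) \<Rightarrow> bool" where
  "field_embedding \<iota> \<longleftrightarrow>
     \<iota> 1 = 1 \<and> (\<forall>x y. \<iota> (x + y) = \<iota> x + \<iota> y) \<and> (\<forall>x y. \<iota> (x * y) = \<iota> x * \<iota> y)"

text \<open>The irreducible polynomial below is, up to a unit, the minimal polynomial of \<open>x\<close> over
  the base field.\<close>

definition separable_algebraic_over :: "('k::field \<Rightarrow> 'a::field) \<Rightarrow> 'a \<Rightarrow> bool" where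
  "separable_algebraic_over \<iota> x \<longleftrightarrow>
     (\<exists>p :: 'k poly. irreducible p \<and> separable_poly p \<and> poly (map_poly \<iota> p) x = 0)"

text \<open>\<open>\<iota>\<close> exhibits the type \<open>'a\<close> as a separable closure of the field \<open>'k\<close>: a separable algebraic
  extension that is itself separably closed.\<close>

definition separable_closure :: "('k::field \<Rightarrow> 'a::field) \<Rightarrow> bool" where
  "separable_closure \<iota> \<longleftrightarrow>
     field_embedding \<iota> \<and>
     (\<forall>x. separable_algebraic_over \<iota> x) \<and>
     (\<forall>p :: 'a poly. separable_poly p \<longrightarrow> degree p > 0 \<longrightarrow> (\<exists>x. poly p x = 0))"

definition primitive_root_of_unity :: "nat \<Rightarrow> 'a::field \<Rightarrow> bool" where
  "primitive_root_of_unity n z \<longleftrightarrow> n > 0 \<and> z ^ n = 1 \<and> (\<forall>m. 0 < m \<and> m < n \<longrightarrow> z ^ m \<noteq> 1)"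

definition GL :: "('a::field ^ 'n ^ 'n) monoid" where
  "GL = \<lparr>carrier = {A. invertible A}, mult = (**), one = mat 1\<rparr>"

definition scalar_matrices :: "('a::field ^ 'n ^ 'n) set" where
  "scalar_matrices = {mat c | c. c \<noteq> 0}"

definition PGL :: "('a::field ^ 'n ^ 'n) set monoid" where
  "PGL = GL Mod scalar_matrices"

abbreviation PGL3 :: "('a::field ^ 3 ^ 3) set monoid" where
  "PGL3 \<equiv> PGL"

text \<open>A linear form in three variables is represented by its coefficient vector.\<close>

definition varX :: "'a::field ^ 3" (\<open>\<X>\<close>) where "\<X> = axis 1 1"
definition varY :: "'a::field ^ 3" (\<open>\<Y>\<close>) where "\<Y> = axis 2 1"
definition varZ :: "'a::field ^ 3" (\<open>\<Z>\<close>) where "\<Z> = axis 3 1"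

text \<open>The rows of the matrix are the coefficient vectors of the three forms, so that its action
  on column vectors sends \<open>(X : Y : Z)\<close> to \<open>(L1 : L2 : L3)\<close>.\<close>

definition proj_map ::
  "'a::field ^ 3 \<Rightarrow> 'a ^ 3 \<Rightarrow> 'a ^ 3 \<Rightarrow> ('a ^ 3 ^ 3) set" (\<open>\<lbrakk>_ : _ : _\<rbrakk>\<close> [51, 51, 51]) where
  "\<lbrakk>L1 : L2 : L3\<rbrakk> = scalar_matrices #>\<^bsub>GL\<^esub> vector [L1, L2, L3]"

definition diagonal_subgroup :: "('a::field ^ 3 ^ 3) set set" where
  "diagonal_subgroup =
     {\<lbrakk>a *s \<X> : b *s \<Y> : c *s \<Z>\<rbrakk> | a b c. a \<noteq> 0 \<and> b \<noteq> 0 \<and> c \<noteq> 0}"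

definition T_X :: "('a::field ^ 3 ^ 3) set set" where
  "T_X = {\<lbrakk>a *s \<X> : \<Y> : \<Z>\<rbrakk> | a. a \<noteq> 0}"

definition GL2_Z :: "('a::field ^ 3 ^ 3) set set" where
  "GL2_Z =
     {\<lbrakk>\<alpha> *s \<X> + \<beta> *s \<Y> : \<gamma> *s \<X> + \<delta> *s \<Y> : \<Z>\<rbrakk> | \<alpha> \<beta> \<gamma> \<delta>. \<alpha> * \<delta> - \<beta> * \<gamma> \<noteq> 0}"

definition S3_tilde :: "('a::field ^ 3 ^ 3) set set" where
  "S3_tilde = generate PGL3 {\<lbrakk>\<X> : \<Z> : \<Y>\<rbrakk>, \<lbrakk>\<Z> : \<X> : \<Y>\<rbrakk>}"

text \<open>The arguments \<open>z3\<close> and \<open>z5\<close> are the chosen primitive third and fifth roots of unity.\<close>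

definition G03 :: "'a::field \<Rightarrow> ('a ^ 3 ^ 3) set set" where
  "G03 z3 = generate PGL3 {\<lbrakk>\<X> : \<Z> : \<Y>\<rbrakk>, \<lbrakk>\<X> : z3 *s \<Y> : \<Z>\<rbrakk>}"

definition G05 :: "'a::field \<Rightarrow> ('a ^ 3 ^ 3) set set" where
  "G05 z5 = generate PGL3 {\<lbrakk>\<X> : \<Z> : \<Y>\<rbrakk>, \<lbrakk>\<X> : \<Y> : z5 *s \<Z>\<rbrakk>}"

text \<open>The dihedral group of order \<open>2 * n\<close> as a semidirect product: \<open>(i, s)\<close> stands for the
  rotation by \<open>i\<close> steps, preceded by the reflection if \<open>s\<close> holds.\<close>

definition dihedral_group :: "nat \<Rightarrow> (int \<times> bool) monoid" where
  "dihedral_group n =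
     \<lparr>carrier = {0..<int n} \<times> UNIV,
      mult = (\<lambda>(i, s) (j, t). ((if s then i - j else i + j) mod int n, s \<noteq> t)),
      one = (0, False)\<rparr>"

end

theory Submission
  imports Defs "HOL-Analysis.Determinants" "HOL-Algebra.Multiplicative_Group"
begin

text \<open>The class of \<open>M\<close> normalizes the group generated by the class of \<open>diag d\<close> iff there are \<open>k\<close> and
  \<open>c \<noteq> 0\<close> such that \<open>d j = c * d i ^ k\<close> whenever \<open>M i j \<noteq> 0\<close>. If the entries of \<open>d\<close> are distinct,
  this forces \<open>M\<close> to be monomial and leaves a congruence condition on its permutation; if \<open>d\<close> is a
  homology \<open>(1, 1, z)\<close>, it forces \<open>M\<close> to be block diagonal. In the dihedral groups of order \<open>2 n\<close>
  with \<open>n\<close> odd, the rotations are the squares, so the normalizer of the group lies in the one of its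
  rotation subgroup, hence consists of monomial classes; compatibility with the reflection then
  makes the permutation fix the first coordinate and the ratio of the last two entries a power
  of \<open>z\<close>.\<close>

subsection \<open>Normalizers, cyclic groups and dihedral groups\<close>

text \<open>Equality in the projective group is equality up to a scalar, which is where
  \<open>c\<close> comes from: that \<open>M\<close> conjugates the generator to its
  \<open>k\<close>-th power reads \<open>M ** diag d = c * diag (d ^ k) ** M\<close>, and
  \<open>M i j\<close> cancels unless it is zero. No inverse matrix is computed. That
  \<open>k\<close> is prime to the order comes for free: conjugation is injective and the groups are
  finite, so it suffices that generators are mapped into the group. With
  \<open>d i = z ^ e i\<close>, the permutation must act on the exponents by an affine map modulo
  \<open>n\<close>. The exponents 0, 1, 2 fill the integers modulo 3, where every permutation is
  affine; 0, 1, 2 modulo 4 and 0, 1, 4 modulo 8 admit one nontrivial symmetry, the reversal; 0, 2, 5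
  modulo 10 admit none. In the dihedral case the danger is an element that conjugates rotations to
  reflections; passing to squares excludes it without counting orders. The first coordinate has
  exponent 0 and is fixed by the reflection, so its scaling is free, which produces
  \<open>T_X\<close>; the ratio of the other two is left discrete.\<close>

lemma (in group) normalizer_subset_carrier: "normalizer G H \<subseteq> carrier G"
  by (auto simp: normalizer_def stabilizer_def)

text \<open>The library normalizer is a stabilizer for the conjugation action on subsets of the
  carrier, hence the assumption; unfolding the cosets gives the usual elementwise form.\<close>

lemma (in group) mem_normalizer_iff:
  assumes "H \<subseteq> carrier G"
  shows "n \<in> normalizer G H \<longleftrightarrow> n \<in> carrier G \<and> (\<lambda>h. n \<otimes> h \<otimes> inv n) ` H = H"
proof -
  have "(n <# H) #> inv n = (\<lambda>h. n \<otimes> h \<otimes> inv n) ` H"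
    by (auto simp: l_coset_def r_coset_def)
  then show ?thesis
    using assms by (auto simp: normalizer_def stabilizer_def)
qed

lemma (in group) inj_on_conjugation:
  assumes "n \<in> carrier G" "H \<subseteq> carrier G"
  shows "inj_on (\<lambda>h. n \<otimes> h \<otimes> inv n) H"
proof (rule inj_onI)
  fix x y assume "x \<in> H" "y \<in> H" and eq: "n \<otimes> x \<otimes> inv n = n \<otimes> y \<otimes> inv n"
  then have "x \<in> carrier G" "y \<in> carrier G" using assms by auto
  with eq assms show "x = y" by simp
qed

text \<open>Conjugation is an injective homomorphism, so once it sends the generators into the group
  it sends the whole group into itself, and finiteness upgrades this to equality. In an infinite
  group the image could be a proper subgroup.\<close>

lemma (in group) mem_normalizer_generate_iff:
  assumes S: "S \<subseteq> carrier G" and fin: "finite (generate G S)"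
  shows "n \<in> normalizer G (generate G S) \<longleftrightarrow>
    n \<in> carrier G \<and> (\<forall>s\<in>S. n \<otimes> s \<otimes> inv n \<in> generate G S)"
proof -
  let ?H = "generate G S"
  have Hc: "?H \<subseteq> carrier G" using generate_incl[OF S] .
  have sub: "subgroup ?H G" using generate_is_subgroup[OF S] .
  have "(\<lambda>h. n \<otimes> h \<otimes> inv n) ` ?H = ?H"
    if n: "n \<in> carrier G" and conj: "\<forall>s\<in>S. n \<otimes> s \<otimes> inv n \<in> ?H"
  proof -
    have "n \<otimes> h \<otimes> inv n \<in> ?H" if "h \<in> ?H" for h
      using that
    proof (induction h rule: generate.induct)
      case one
      then show ?case using n sub by (simp add: subgroup.one_closed)
    next
      case (incl h)
      then show ?case using conj by blast
    next
      case (inv h)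
      then have hc: "h \<in> carrier G" using S by auto
      have "inv (n \<otimes> h \<otimes> inv n) \<in> ?H"
        using inv conj sub by (meson subgroup.m_inv_closed)
      also have "inv (n \<otimes> h \<otimes> inv n) = n \<otimes> inv h \<otimes> inv n"
        using n hc by (simp add: inv_mult_group m_assoc)
      finally show ?case .
    next
      case (eng h1 h2)
      have hc: "h1 \<in> carrier G" "h2 \<in> carrier G" using eng.hyps Hc by auto
      have "(n \<otimes> h1 \<otimes> inv n) \<otimes> (n \<otimes> h2 \<otimes> inv n) \<in> ?H"
        using eng.IH sub by (meson subgroup.m_closed)
      also have "(n \<otimes> h1 \<otimes> inv n) \<otimes> (n \<otimes> h2 \<otimes> inv n) = n \<otimes> (h1 \<otimes> h2) \<otimes> inv n"
      proof -
        have "(n \<otimes> h1 \<otimes> inv n) \<otimes> (n \<otimes> h2 \<otimes> inv n) = n \<otimes> h1 \<otimes> (inv n \<otimes> n) \<otimes> h2 \<otimes> inv n"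
          using n hc by (simp only: m_assoc m_closed inv_closed)
        then show ?thesis using n hc by (simp add: m_assoc)
      qed
      finally show ?case .
    qed
    then show ?thesis
      using endo_inj_surj[OF fin _ inj_on_conjugation[OF n Hc]] by blast
  qed
  then show ?thesis
    using mem_normalizer_iff[OF Hc] generate.incl[of _ S G] by blast
qed

lemma (in group) int_pow_eq_iff_mod:
  assumes "a \<in> carrier G"
  shows "a [^] (i::int) = a [^] (j::int) \<longleftrightarrow> i mod int (ord a) = j mod int (ord a)"
  unfolding int_pow_eq[OF assms] mod_eq_dvd_iff by (rule dvd_diff_commute)

text \<open>The isomorphism is built in the direction in which it has a formula, from residues to
  powers, and inverted at the end. Reduction modulo \<open>n\<close> is harmless because
  \<open>n\<close> is the order of \<open>a\<close>.\<close>

lemma (in group) cyclic_iso_integer_mod_group: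
  assumes a: "a \<in> carrier G" and n: "ord a = n" "n > 0"
  shows "G\<lparr>carrier := generate G {a}\<rparr> \<cong> integer_mod_group n"
proof -
  let ?H = "G\<lparr>carrier := generate G {a}\<rparr>"
  have mod: "a [^] (i mod int n) = a [^] i" for i :: int
    unfolding int_pow_eq_iff_mod[OF a] n by simp
  have "(\<lambda>i::int. a [^] i) \<in> iso (integer_mod_group n) ?H"
  proof (rule isoI)
    show "(\<lambda>i::int. a [^] i) \<in> hom (integer_mod_group n) ?H"
      using a by (intro homI) (auto simp: generate_pow mod int_pow_mult)
    show "bij_betw (\<lambda>i::int. a [^] i) (carrier (integer_mod_group n)) (carrier ?H)"
      unfolding bij_betw_def
    proof
      show "inj_on (\<lambda>i::int. a [^] i) (carrier (integer_mod_group n))"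
        using n by (intro inj_onI)
          (auto simp: carrier_integer_mod_group int_pow_eq_iff_mod[OF a])
      show "(\<lambda>i::int. a [^] i) ` carrier (integer_mod_group n) = carrier ?H"
      proof
        show "carrier ?H \<subseteq> (\<lambda>i::int. a [^] i) ` carrier (integer_mod_group n)"
        proof
          fix x assume "x \<in> carrier ?H"
          then obtain i :: int where "x = a [^] (i mod int n)"
            using a by (auto simp: generate_pow mod)
          then show "x \<in> (\<lambda>i::int. a [^] i) ` carrier (integer_mod_group n)"
            using n by (auto simp: carrier_integer_mod_group)
        qed
      qed (use a in \<open>auto simp: generate_pow\<close>)
    qed
  qed
  then have "integer_mod_group n \<cong> ?H" by (auto simp: is_iso_def)
  then show ?thesis
    using group.iso_sym[OF group_integer_mod_group] by blast
qed

section \<open>Dihedral groups and pairs satisfying the dihedral relations\<close>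

lemma group_dihedral_group:
  assumes "n > 0"
  shows "group (dihedral_group n)"
proof (rule groupI)
  fix x assume "x \<in> carrier (dihedral_group n)"
  then obtain i s where x: "x = (i, s)" "0 \<le> i" "i < int n"
    by (auto simp: dihedral_group_def)
  show "\<exists>y\<in>carrier (dihedral_group n). y \<otimes>\<^bsub>dihedral_group n\<^esub> x = \<one>\<^bsub>dihedral_group n\<^esub>"
    using assms x
    \<comment> \<open>Reflections are involutions; a rotation by \<open>i\<close> is undone by the
      rotation by \<open>- i\<close>.\<close>
    by (intro bexI[of _ "if s then x else ((- i) mod int n, False)"])
      (auto simp: dihedral_group_def mod_simps)
next
  fix x y z
  show "x \<otimes>\<^bsub>dihedral_group n\<^esub> y \<otimes>\<^bsub>dihedral_group n\<^esub> z =
      x \<otimes>\<^bsub>dihedral_group n\<^esub> (y \<otimes>\<^bsub>dihedral_group n\<^esub> z)"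
  proof -
    obtain i a j b k c where "x = (i, a)" "y = (j, b)" "z = (k, c)"
      by (cases x, cases y, cases z)
    then show ?thesis
      by (cases a; cases b; simp add: dihedral_group_def mod_simps; simp add: algebra_simps)
  qed
next
  fix x y assume "x \<in> carrier (dihedral_group n)" "y \<in> carrier (dihedral_group n)"
  then show "x \<otimes>\<^bsub>dihedral_group n\<^esub> y \<in> carrier (dihedral_group n)"
    using assms by (cases x; cases y; simp add: dihedral_group_def)
next
  show "\<one>\<^bsub>dihedral_group n\<^esub> \<in> carrier (dihedral_group n)"
    using assms by (simp add: dihedral_group_def)
next
  fix x assume "x \<in> carrier (dihedral_group n)"
  then show "\<one>\<^bsub>dihedral_group n\<^esub> \<otimes>\<^bsub>dihedral_group n\<^esub> x = x"
    by (cases x) (simp add: dihedral_group_def)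
qed

text \<open>The dihedral relations in an arbitrary ambient group. They alone allow the generated
  group to collapse to a quotient; \<open>ord_g\<close> and \<open>s_notin\<close> make its order
  exactly \<open>2 * n\<close>.\<close>

locale dihedral_pair = group +
  fixes g s :: 'a and n :: nat
  assumes g_closed: "g \<in> carrier G" and s_closed: "s \<in> carrier G"
    and ord_g: "ord g = n" and n_pos: "n > 0"
    and s_square: "s \<otimes> s = \<one>" and conj_g: "s \<otimes> g \<otimes> s = inv g"
    and s_notin: "s \<notin> generate G {g}"
begin

text \<open>The normal form of a word in \<open>g\<close> and \<open>s\<close>, with the factors in
  the order that matches \<open>dihedral_group\<close>. The exponent stays unreduced so that
  products are computed over the integers; \<open>elt_mod\<close> reduces it afterwards.\<close>

definition elt :: "int \<times> bool \<Rightarrow> 'a" where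
  "elt = (\<lambda>(i, b). g [^] i \<otimes> (if b then s else \<one>))"

lemma elt_False: "elt (i, False) = g [^] i" and elt_True: "elt (i, True) = g [^] i \<otimes> s"
  using g_closed by (auto simp: elt_def)

text \<open>Since \<open>s\<close> is its own inverse, \<open>s \<otimes> x \<otimes> s\<close> is a
  homomorphism in \<open>x\<close>; it inverts \<open>g\<close>, hence every power of
  \<open>g\<close>.\<close>

lemma s_g_pow: "s \<otimes> g [^] (i::int) = g [^] (- i) \<otimes> s"
proof -
  have inv_s: "inv s = s" using s_square s_closed by (simp add: inv_equality)
  have hom: "group_hom G G (\<lambda>x. s \<otimes> x \<otimes> s)"
  proof (unfold_locales, rule homI)
    fix x y assume xy: "x \<in> carrier G" "y \<in> carrier G"
    have "(s \<otimes> x \<otimes> s) \<otimes> (s \<otimes> y \<otimes> s) = s \<otimes> x \<otimes> (s \<otimes> s) \<otimes> y \<otimes> s"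
      using xy s_closed by (simp only: m_assoc m_closed)
    then show "s \<otimes> (x \<otimes> y) \<otimes> s = (s \<otimes> x \<otimes> s) \<otimes> (s \<otimes> y \<otimes> s)"
      using xy s_closed s_square by (simp add: m_assoc)
  qed (use s_closed in auto)
  have eq: "s \<otimes> g [^] i \<otimes> s = g [^] (- i)"
    using group_hom.hom_int_pow[OF hom g_closed, of i] conj_g g_closed
    by (simp add: int_pow_inv int_pow_neg)
  have "s \<otimes> g [^] i = s \<otimes> g [^] i \<otimes> (s \<otimes> s)"
    using s_square g_closed s_closed by simp
  also have "\<dots> = (s \<otimes> g [^] i \<otimes> s) \<otimes> s"
    using g_closed s_closed by (simp add: m_assoc)
  finally show ?thesis using eq by simp
qed

lemma elt_mult: "elt (i, a) \<otimes> elt (j, b) = elt (if a then i - j else i + j, a \<noteq> b)"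
proof -
  note cl = g_closed s_closed
  have *: "g [^] i \<otimes> s \<otimes> g [^] j = g [^] (i - j) \<otimes> s"
    using cl s_g_pow[of j] int_pow_mult[of g i "-j"] by (simp add: m_assoc)
  moreover have "g [^] i \<otimes> s \<otimes> (g [^] j \<otimes> s) = g [^] (i - j)"
  proof -
    have "g [^] i \<otimes> s \<otimes> (g [^] j \<otimes> s) = g [^] i \<otimes> s \<otimes> g [^] j \<otimes> s"
      using cl by (simp add: m_assoc)
    also have "\<dots> = g [^] (i - j) \<otimes> (s \<otimes> s)"
      unfolding * using cl by (simp add: m_assoc)
    finally show ?thesis using cl s_square by simp
  qed
  ultimately show ?thesis
    using * cl by (cases a; cases b) (auto simp: elt_False elt_True int_pow_mult m_assoc)
qed

lemma elt_mod: "elt (i mod int n, a) = elt (i, a)"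
proof -
  have "g [^] (i mod int n) = g [^] i"
    unfolding int_pow_eq_iff_mod[OF g_closed] ord_g by simp
  then show ?thesis by (simp add: elt_def)
qed

lemma generate_eq_range_elt: "generate G {g, s} = range elt"
proof
  show "generate G {g, s} \<subseteq> range elt"
  proof
    fix x assume "x \<in> generate G {g, s}"
    then show "x \<in> range elt"
    proof (induction rule: generate.induct)
      case one
      then show ?case using elt_False[of 0] by (intro range_eqI[of _ _ "(0, False)"]) simp
    next
      case (incl h)
      have "g = elt (1, False)" "s = elt (0, True)"
        using g_closed s_closed by (auto simp: elt_False elt_True)
      then show ?case using incl by blast
    next
      case (inv h)
      have "inv g = elt (-1, False)" "inv s = elt (0, True)"
        using g_closed s_closed s_square
        by (auto simp: elt_False elt_True int_pow_neg inv_equality)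
      then show ?case using inv by blast
    next
      case (eng h1 h2)
      then obtain i a j b where "h1 = elt (i, a)" "h2 = elt (j, b)" by auto
      then show ?case by (simp add: elt_mult)
    qed
  qed
  have sub: "subgroup (generate G {g, s}) G"
    using g_closed s_closed by (intro generate_is_subgroup) auto
  have mem: "g \<in> generate G {g, s}" "s \<in> generate G {g, s}"
    by (auto intro: generate.incl)
  have "elt x \<in> generate G {g, s}" for x
    using mem sub subgroup_int_pow_closed[OF sub mem(1)]
    by (cases x) (auto simp: elt_def intro: subgroup.m_closed subgroup.one_closed)
  then show "range elt \<subseteq> generate G {g, s}" by blast
qed

lemma elt_image: "elt ` carrier (dihedral_group n) = generate G {g, s}"
proof -
  have "elt x \<in> elt ` carrier (dihedral_group n)" for x
  proof -
    have "elt x = elt (fst x mod int n, snd x)" by (simp add: elt_mod)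
    moreover have "(fst x mod int n, snd x) \<in> carrier (dihedral_group n)"
      using n_pos by (auto simp: dihedral_group_def)
    ultimately show ?thesis by blast
  qed
  then show ?thesis by (auto simp: generate_eq_range_elt)
qed

lemma inj_on_elt: "inj_on elt (carrier (dihedral_group n))"
proof (rule inj_onI)
  fix x y assume xy: "x \<in> carrier (dihedral_group n)" "y \<in> carrier (dihedral_group n)"
    and eq: "elt x = elt y"
  obtain i a j b where x: "x = (i, a)" and y: "y = (j, b)" by (cases x, cases y)
  \<comment> \<open>A rotation equal to a reflection would exhibit \<open>s\<close> as a power of
    \<open>g\<close>.\<close>
  have ne: "g [^] (k::int) \<noteq> g [^] (l::int) \<otimes> s" for k l
  proof
    assume "g [^] k = g [^] l \<otimes> s"
    then have "s = inv (g [^] l) \<otimes> g [^] k"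
      using g_closed s_closed by (simp add: inv_solve_left)
    then have "s = g [^] (k - l)"
      using g_closed int_pow_mult[of g "-l" k] by (simp add: int_pow_neg)
    then show False using s_notin g_closed by (auto simp: generate_pow)
  qed
  have ab: "a = b"
    using eq ne[of i j] ne[of j i] x y by (cases a; cases b) (auto simp: elt_False elt_True)
  then have "g [^] i = g [^] j"
    using eq x y g_closed s_closed by (cases b) (auto simp: elt_False elt_True)
  then have "i mod int n = j mod int n"
    unfolding int_pow_eq_iff_mod[OF g_closed] ord_g .
  then show "x = y" using x y xy ab by (auto simp: dihedral_group_def)
qed

lemma generate_iso_dihedral_group:
  "G\<lparr>carrier := generate G {g, s}\<rparr> \<cong> dihedral_group n"
proof -
  have "elt \<in> iso (dihedral_group n) (G\<lparr>carrier := generate G {g, s}\<rparr>)"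
  proof (rule isoI)
    show "elt \<in> hom (dihedral_group n) (G\<lparr>carrier := generate G {g, s}\<rparr>)"
    proof (rule homI)
      fix x y
      show "elt (x \<otimes>\<^bsub>dihedral_group n\<^esub> y) =
          elt x \<otimes>\<^bsub>G\<lparr>carrier := generate G {g, s}\<rparr>\<^esub> elt y"
        by (cases x; cases y) (auto simp: dihedral_group_def elt_mod elt_mult)
    qed (auto simp: elt_image[symmetric])
  qed (use inj_on_elt elt_image in \<open>simp add: bij_betw_def\<close>)
  then have "dihedral_group n \<cong> G\<lparr>carrier := generate G {g, s}\<rparr>" by (auto simp: is_iso_def)
  then show ?thesis using group.iso_sym[OF group_dihedral_group[OF n_pos]] by blast
qed

lemma card_generate: "card (generate G {g, s}) = 2 * n"
  using card_image[OF inj_on_elt] unfolding elt_image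
  by (simp add: dihedral_group_def card_cartesian_product)

lemma finite_generate: "finite (generate G {g, s})"
  unfolding elt_image[symmetric] by (auto simp: dihedral_group_def)

text \<open>Natural exponents are available because the representatives in
  \<open>dihedral_group\<close> are nonnegative; they are what the formula for powers of diagonal
  classes accepts.\<close>

lemma mem_generate_cases:
  assumes "x \<in> generate G {g, s}"
  obtains k :: nat where "x = g [^] k" | k :: nat where "x = g [^] k \<otimes> s"
proof -
  from assms obtain i a where ia: "x = elt (i, a)" "0 \<le> i"
    unfolding elt_image[symmetric] by (auto simp: dihedral_group_def)
  have "g [^] i = g [^] nat i" using ia(2) by (metis int_pow_int nat_0_le)
  then have "x = g [^] nat i \<or> x = g [^] nat i \<otimes> s"
    using ia(1) by (cases a) (simp_all add: elt_False elt_True)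
  then show ?thesis using that by blast
qed

text \<open>For odd \<open>n\<close> every rotation is the square of a rotation, and squares of arbitrary elements of
  the dihedral group are rotations.\<close>

lemma normalizer_dihedral_subset_normalizer_cyclic:
  assumes "odd n"
  shows "normalizer G (generate G {g, s}) \<subseteq> normalizer G (generate G {g})"
proof
  fix x assume x: "x \<in> normalizer G (generate G {g, s})"
  then have xc: "x \<in> carrier G" using normalizer_subset_carrier by blast
  have sub: "subgroup (generate G {g}) G"
    using g_closed by (intro generate_is_subgroup) auto
  have fin: "finite (generate G {g})"
    using finite_generate mono_generate[of "{g}" "{g, s}"] finite_subset by blast
  \<comment> \<open>As \<open>n\<close> is odd, \<open>2 * m = n + 1\<close>, so the
    \<open>m\<close>-th power of \<open>g\<close> is a square root of \<open>g\<close>, and the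
    conjugate of \<open>g\<close> by \<open>x\<close> is the square of \<open>y\<close>.\<close>
  define m where "m = Suc n div 2"
  define y where "y = x \<otimes> g [^] m \<otimes> inv x"
  have "g [^] m \<otimes> g [^] m = g [^] Suc n"
  proof -
    have "m + m = Suc n" using assms unfolding m_def by presburger
    then show ?thesis using g_closed nat_pow_mult[of g m m] by simp
  qed
  also have "\<dots> = g" using g_closed ord_g pow_ord_eq_1[of g] by simp
  finally have gm: "g [^] m \<otimes> g [^] m = g" .
  have "y \<otimes> y = x \<otimes> g [^] m \<otimes> (inv x \<otimes> x) \<otimes> g [^] m \<otimes> inv x"
    unfolding y_def using xc g_closed by (simp only: m_assoc m_closed inv_closed nat_pow_closed)
  also have "\<dots> = x \<otimes> (g [^] m \<otimes> g [^] m) \<otimes> inv x"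
    using xc g_closed by (simp add: m_assoc)
  finally have yy: "y \<otimes> y = x \<otimes> g \<otimes> inv x" by (simp only: gm)
  have "g [^] m \<in> generate G {g, s}"
    using elt_False[of "int m"] unfolding generate_eq_range_elt
    by (intro range_eqI[of _ _ "(int m, False)"]) (simp add: int_pow_int)
  then have "y \<in> generate G {g, s}"
    using x mem_normalizer_iff[of "generate G {g, s}" x] generate_incl[of "{g, s}"] g_closed s_closed
    unfolding y_def by auto
  then obtain i a where y: "y = elt (i, a)" unfolding generate_eq_range_elt by auto
  \<comment> \<open>A reflection squares to exponent \<open>i - i = 0\<close>, a rotation to
    exponent \<open>i + i\<close>; either way the result is a power of \<open>g\<close>.\<close>
  have "elt (i, a) \<otimes> elt (i, a) = g [^] (if a then i - i else i + i)"
    unfolding elt_mult by (simp only: elt_False simp_thms)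
  then have "elt (i, a) \<otimes> elt (i, a) \<in> generate G {g}"
    unfolding generate_pow[OF g_closed] by blast
  then have "x \<otimes> g \<otimes> inv x \<in> generate G {g}" using y yy by simp
  then show "x \<in> normalizer G (generate G {g})"
    using mem_normalizer_generate_iff[of "{g}" x] g_closed fin xc by simp
qed

end

text \<open>A 3-cycle \<open>c\<close> and a transposition \<open>t\<close> satisfy the dihedral
  relations, so they generate a subgroup of order 6. This is the order of the whole symmetric
  group.\<close>

lemma dihedral_group_3_iso_sym_group: "dihedral_group 3 \<cong> sym_group 3"
proof -
  define c :: "nat \<Rightarrow> nat" where
    "c = (\<lambda>x. if x = 1 then 2 else if x = 2 then 3 else if x = 3 then 1 else x)"
  define t :: "nat \<Rightarrow> nat" where
    "t = (\<lambda>x. if x = 1 then 2 else if x = 2 then 1 else x)"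
  interpret S: group "sym_group 3" by (rule sym_group_is_group)
  have c: "c \<in> carrier (sym_group 3)"
    unfolding sym_group_carrier by (rule bij_imp_permutes)
      (auto simp: c_def intro!: bij_betwI[where g = "c \<circ> c"])
  have t: "t \<in> carrier (sym_group 3)"
    unfolding sym_group_carrier by (rule bij_imp_permutes)
      (auto simp: t_def intro!: bij_betwI[where g = t])
  have c3: "c [^]\<^bsub>sym_group 3\<^esub> (3::nat) = \<one>\<^bsub>sym_group 3\<^esub>"
    by (auto simp: numeral_3_eq_3 sym_group_mult sym_group_one c_def fun_eq_iff)
  have ord: "S.ord c = 3"
  proof -
    have "S.ord c dvd 3" using S.pow_eq_id[OF c] c3 by simp
    moreover have "S.ord c \<noteq> 1"
      using S.ord_eq_1[OF c] by (auto simp: sym_group_one c_def fun_eq_iff)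
    ultimately show ?thesis
      using prime_nat_iff[of 3] by force
  qed
  interpret dihedral_pair "sym_group 3" c t 3
  proof unfold_locales
    show "t \<otimes>\<^bsub>sym_group 3\<^esub> t = \<one>\<^bsub>sym_group 3\<^esub>"
      by (auto simp: sym_group_mult sym_group_one t_def fun_eq_iff)
    show "t \<otimes>\<^bsub>sym_group 3\<^esub> c \<otimes>\<^bsub>sym_group 3\<^esub> t = inv\<^bsub>sym_group 3\<^esub> c"
    proof (rule S.inv_equality[symmetric])
      show "t \<otimes>\<^bsub>sym_group 3\<^esub> c \<otimes>\<^bsub>sym_group 3\<^esub> t \<otimes>\<^bsub>sym_group 3\<^esub> c = \<one>\<^bsub>sym_group 3\<^esub>"
        by (auto simp: sym_group_mult sym_group_one t_def c_def fun_eq_iff)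
    qed (use c t in auto)
    show "t \<notin> generate (sym_group 3) {c}"
    proof
      assume "t \<in> generate (sym_group 3) {c}"
      then obtain k :: nat where k: "t = c [^]\<^bsub>sym_group 3\<^esub> k"
        using S.generate_pow_nat[OF c] ord by auto
      \<comment> \<open>A power of \<open>c\<close> commutes with \<open>c\<close>, whereas the two
        composites of \<open>t\<close> and \<open>c\<close> send 1 to 1 and to 3.\<close>
      have "t \<otimes>\<^bsub>sym_group 3\<^esub> c = c \<otimes>\<^bsub>sym_group 3\<^esub> t"
        unfolding k using S.nat_pow_comm[OF c, of k 1] c S.nat_pow_Suc2 by simp
      then have "(t \<circ> c) 1 = (c \<circ> t) 1" by (simp add: sym_group_mult)
      then show False by (simp add: t_def c_def)
    qed
  qed (use c t ord in auto)
  have fin: "finite (carrier (sym_group 3))"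
    by (simp add: sym_group_def finite_permutations)
  have "card (carrier (sym_group 3)) = 6"
    using card_permutations[of "{1..3::nat}" 3] by (simp add: sym_group_def fact_numeral)
  moreover have "generate (sym_group 3) {c, t} \<subseteq> carrier (sym_group 3)"
    using c t by (intro S.generate_incl) auto
  ultimately have "generate (sym_group 3) {c, t} = carrier (sym_group 3)"
    using card_generate fin by (intro card_subset_eq) auto
  then have "sym_group 3 \<cong> dihedral_group 3"
    using generate_iso_dihedral_group by simp
  then show ?thesis using S.iso_sym by blast
qed

subsection \<open>The projective linear group\<close>

lemma mat_mult_nth: "(mat c ** A) $ i $ j = c * A $ i $ j"
  for A :: "'a::field ^ 'n ^ 'n"
  by (simp add: matrix_matrix_mult_def mat_def if_distrib[of "\<lambda>x. x * _"] cong: if_cong)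

lemma mult_mat_nth: "(A ** mat c) $ i $ j = A $ i $ j * c"
  for A :: "'a::field ^ 'n ^ 'n"
  by (simp add: matrix_matrix_mult_def mat_def if_distrib[of "\<lambda>x. _ * x"] cong: if_cong)

lemma mat_mult_mat: "mat c ** mat d = (mat (c * d) :: 'a::field ^ 'n ^ 'n)"
  by (simp add: vec_eq_iff mat_mult_nth) (simp add: mat_def)

lemma invertible_matrix_mult:
  "invertible A \<Longrightarrow> invertible B \<Longrightarrow> invertible (A ** B)"
  for A B :: "'a::field ^ 'n ^ 'n"
  by (simp add: invertible_det_nz det_mul)

lemma invertible_mat_1: "invertible (mat 1 :: 'a::field ^ 'n ^ 'n)"
  by (auto simp: invertible_def)

lemma group_GL: "group (GL :: ('a::field ^ 'n ^ 'n) monoid)"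
proof (rule groupI)
  fix A :: "'a ^ 'n ^ 'n" assume "A \<in> carrier GL"
  then obtain B where "A ** B = mat 1" "B ** A = mat 1" by (auto simp: GL_def invertible_def)
  then show "\<exists>B\<in>carrier GL. B \<otimes>\<^bsub>GL\<^esub> A = \<one>\<^bsub>GL\<^esub>"
    by (auto simp: GL_def invertible_def)
qed (auto simp: GL_def invertible_mat_1 invertible_matrix_mult matrix_mul_assoc)

interpretation GL: group "GL :: ('a::field ^ 'n ^ 'n) monoid"
  by (rule group_GL)

lemma invertible_mat: "c \<noteq> 0 \<Longrightarrow> invertible (mat c :: 'a::field ^ 'n ^ 'n)"
  unfolding invertible_def by (rule exI[of _ "mat (inverse c)"]) (simp add: mat_mult_mat)

lemma subgroup_scalar_matrices: "subgroup (scalar_matrices :: ('a::field ^ 'n ^ 'n) set) GL"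
proof (rule GL.subgroupI)
  fix A :: "'a ^ 'n ^ 'n" assume "A \<in> scalar_matrices"
  then obtain c where c: "A = mat c" "c \<noteq> 0" by (auto simp: scalar_matrices_def)
  then have "inv\<^bsub>GL\<^esub> A = mat (inverse c)"
    by (intro GL.inv_equality) (auto simp: GL_def mat_mult_mat invertible_mat)
  with c show "inv\<^bsub>GL\<^esub> A \<in> scalar_matrices" by (auto simp: scalar_matrices_def)
next
  fix A B :: "'a ^ 'n ^ 'n" assume "A \<in> scalar_matrices" "B \<in> scalar_matrices"
  then show "A \<otimes>\<^bsub>GL\<^esub> B \<in> scalar_matrices"
    by (force simp: scalar_matrices_def GL_def mat_mult_mat)
qed (auto simp: scalar_matrices_def GL_def invertible_mat intro: exI[of _ 1])

lemma normal_scalar_matrices: "normal (scalar_matrices :: ('a::field ^ 'n ^ 'n) set) GL"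
proof (rule GL.normalI[OF subgroup_scalar_matrices], intro ballI)
  fix A :: "'a ^ 'n ^ 'n"
  have "mat c ** A = A ** mat c" for c by (simp add: vec_eq_iff mat_mult_nth mult_mat_nth)
  then show "scalar_matrices #>\<^bsub>GL\<^esub> A = A <#\<^bsub>GL\<^esub> scalar_matrices"
    by (auto simp: r_coset_def l_coset_def GL_def scalar_matrices_def)
qed

section \<open>Classes of matrices modulo scalars\<close>

interpretation PGL: group "PGL :: ('a::field ^ 'n ^ 'n) set monoid"
  unfolding PGL_def by (rule normal.factorgroup_is_group[OF normal_scalar_matrices])

text \<open>The class is formed for every matrix, singular ones included, so that the equality
  criterion \<open>pgl_eq_iff\<close> carries no side conditions; invertibility enters only with the
  group operations.\<close>

definition pgl :: "'a::field ^ 'n ^ 'n \<Rightarrow> ('a ^ 'n ^ 'n) set" where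
  "pgl A = scalar_matrices #>\<^bsub>GL\<^esub> A"

lemma mem_pgl: "B \<in> pgl A \<longleftrightarrow> (\<exists>c. c \<noteq> 0 \<and> (\<forall>i j. B $ i $ j = c * A $ i $ j))"
proof -
  have "B = mat c ** A \<longleftrightarrow> (\<forall>i j. B $ i $ j = c * A $ i $ j)" for c
    by (simp add: vec_eq_iff mat_mult_nth)
  then show ?thesis by (auto simp: pgl_def r_coset_def scalar_matrices_def GL_def)
qed

lemma pgl_eq_iff: "pgl A = pgl B \<longleftrightarrow> (\<exists>c. c \<noteq> 0 \<and> (\<forall>i j. A $ i $ j = c * B $ i $ j))"
proof
  have "A \<in> pgl A" unfolding mem_pgl by (rule exI[of _ 1]) simp
  moreover assume "pgl A = pgl B"
  ultimately show "\<exists>c. c \<noteq> 0 \<and> (\<forall>i j. A $ i $ j = c * B $ i $ j)"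
    using mem_pgl by blast
next
  assume "\<exists>c. c \<noteq> 0 \<and> (\<forall>i j. A $ i $ j = c * B $ i $ j)"
  then obtain c where c: "c \<noteq> 0" "\<And>i j. A $ i $ j = c * B $ i $ j" by blast
  show "pgl A = pgl B"
  proof (rule Set.set_eqI, rule iffI)
    fix M assume "M \<in> pgl A"
    then obtain d where "d \<noteq> 0" "\<And>i j. M $ i $ j = d * A $ i $ j" by (auto simp: mem_pgl)
    with c show "M \<in> pgl B" unfolding mem_pgl by (intro exI[of _ "d * c"]) (simp add: mult.assoc)
  next
    fix M assume "M \<in> pgl B"
    then obtain d where "d \<noteq> 0" "\<And>i j. M $ i $ j = d * B $ i $ j" by (auto simp: mem_pgl)
    with c show "M \<in> pgl A" unfolding mem_pgl by (intro exI[of _ "d / c"]) simp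
  qed
qed

lemma carrier_PGL: "carrier PGL = pgl ` {A. invertible A}"
  by (auto simp: PGL_def FactGroup_def RCOSETS_def pgl_def GL_def)

lemma pgl_closed: "invertible A \<Longrightarrow> pgl A \<in> carrier PGL"
  by (auto simp: carrier_PGL)

lemma pgl_mult:
  assumes "invertible A" "invertible B"
  shows "pgl A \<otimes>\<^bsub>PGL\<^esub> pgl B = pgl (A ** B)"
proof -
  have "A \<in> carrier GL" "B \<in> carrier GL" using assms by (auto simp: GL_def)
  from normal.rcos_sum[OF normal_scalar_matrices this] show ?thesis
    by (simp add: PGL_def FactGroup_def pgl_def) (simp add: GL_def)
qed

lemma PGL_one: "\<one>\<^bsub>PGL\<^esub> = pgl (mat 1 :: 'a::field ^ 'n ^ 'n)"
proof -
  have "pgl (mat 1) = (scalar_matrices :: ('a ^ 'n ^ 'n) set)"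
    using GL.coset_mult_one[OF subgroup.subset[OF subgroup_scalar_matrices]]
    by (simp add: pgl_def GL_def)
  then show ?thesis by (simp add: PGL_def FactGroup_def)
qed

text \<open>Moving the inverse to the other side turns a conjugation into a comparison of two matrix
  products, which can be read entry by entry.\<close>

lemma PGL_conj_eq_iff:
  assumes "invertible M" "invertible A" "invertible B"
  shows "pgl M \<otimes>\<^bsub>PGL\<^esub> pgl A \<otimes>\<^bsub>PGL\<^esub> inv\<^bsub>PGL\<^esub> pgl M = pgl B \<longleftrightarrow> pgl (M ** A) = pgl (B ** M)"
  using assms PGL.inv_solve_right'[of "pgl B" "pgl M \<otimes>\<^bsub>PGL\<^esub> pgl A" "pgl M"]
  by (auto simp: pgl_mult pgl_closed invertible_matrix_mult)

text \<open>Row \<open>i\<close> has its only nonzero entry in column \<open>\<sigma> i\<close>, so that products compose the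
  permutations in reverse order.\<close>

definition monomial_matrix :: "('n \<Rightarrow> 'n) \<Rightarrow> 'a::field ^ 'n \<Rightarrow> 'a ^ 'n ^ 'n" where
  "monomial_matrix \<sigma> u = (\<chi> i j. if j = \<sigma> i then u $ i else 0)"

abbreviation diag_matrix :: "'a::field ^ 'n \<Rightarrow> 'a ^ 'n ^ 'n" where
  "diag_matrix \<equiv> monomial_matrix (\<lambda>i. i)"

lemma monomial_matrix_mult:
  "monomial_matrix \<sigma> u ** monomial_matrix \<tau> v =
     monomial_matrix (\<lambda>i. \<tau> (\<sigma> i)) (\<chi> i. u $ i * v $ \<sigma> i)"
  by (simp add: vec_eq_iff matrix_matrix_mult_def monomial_matrix_def
      if_distrib[of "\<lambda>x. x * _"] cong: if_cong)

lemma diag_matrix_1: "diag_matrix (\<chi> i. 1) = mat 1"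
  by (simp add: vec_eq_iff monomial_matrix_def mat_def eq_commute)

lemma invertible_monomial_matrix:
  fixes u :: "'a::field ^ 'n"
  assumes "bij \<sigma>" "\<And>i. u $ i \<noteq> 0"
  shows "invertible (monomial_matrix \<sigma> u)"
proof -
  have "monomial_matrix \<sigma> u ** monomial_matrix (inv' \<sigma>) (\<chi> i. inverse (u $ inv' \<sigma> i)) = mat 1"
    using assms unfolding diag_matrix_1[symmetric] monomial_matrix_mult
    by (simp add: bij_is_inj)
  then show ?thesis by (auto simp: invertible_right_inverse)
qed

lemma invertible_diag_matrix: "(\<And>i. u $ i \<noteq> 0) \<Longrightarrow> invertible (diag_matrix u)"
  by (rule invertible_monomial_matrix) (auto simp: bij_def)

lemma invertible_row_nonzero:
  fixes M :: "'a::field ^ 'n ^ 'n"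
  assumes "invertible M"
  obtains j where "M $ i $ j \<noteq> 0"
proof -
  obtain N where "M ** N = mat 1" using assms by (auto simp: invertible_def)
  then have "(\<Sum>j\<in>UNIV. M $ i $ j * N $ j $ i) = 1"
    by (simp add: vec_eq_iff matrix_matrix_mult_def mat_def)
  then have "\<exists>j. M $ i $ j \<noteq> 0" by (rule contrapos_pp) simp
  then show ?thesis using that by blast
qed

lemma invertible_column_nonzero:
  fixes M :: "'a::field ^ 'n ^ 'n"
  assumes "invertible M"
  obtains i where "M $ i $ j \<noteq> 0"
proof -
  obtain N where "N ** M = mat 1" using assms by (auto simp: invertible_def)
  then have "(\<Sum>i\<in>UNIV. N $ j $ i * M $ i $ j) = 1"
    by (simp add: vec_eq_iff matrix_matrix_mult_def mat_def)
  then have "\<exists>i. M $ i $ j \<noteq> 0" by (rule contrapos_pp) simp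
  then show ?thesis using that by blast
qed

text \<open>Nonzero rows define \<open>\<sigma>\<close>, nonzero columns make it surjective, and on
  a finite index type it is then bijective.\<close>

lemma monomial_matrixI:
  fixes M :: "'a::field ^ 'n ^ 'n"
  assumes inv: "invertible M"
    and uniq: "\<And>i j k. M $ i $ j \<noteq> 0 \<Longrightarrow> M $ i $ k \<noteq> 0 \<Longrightarrow> j = k"
  obtains \<sigma> u where "bij \<sigma>" "\<And>i. u $ i \<noteq> 0" "M = monomial_matrix \<sigma> u"
proof -
  have "\<forall>i. \<exists>j. M $ i $ j \<noteq> 0" using invertible_row_nonzero[OF inv] by metis
  then obtain \<sigma> where \<sigma>: "\<And>i. M $ i $ \<sigma> i \<noteq> 0" by metis
  have "surj \<sigma>"
  proof (rule surjI)
    fix j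
    show "\<sigma> (SOME i. M $ i $ j \<noteq> 0) = j"
      using invertible_column_nonzero[OF inv, of j] \<sigma> uniq by (metis (mono_tags, lifting) someI_ex)
  qed
  then have "bij \<sigma>" by (simp add: bij_def finite_UNIV_surj_inj)
  moreover have "M = monomial_matrix \<sigma> (\<chi> i. M $ i $ \<sigma> i)"
    using \<sigma> uniq by (auto simp: vec_eq_iff monomial_matrix_def)
  moreover have "(\<chi> i. M $ i $ \<sigma> i) $ i \<noteq> 0" for i using \<sigma> by simp
  ultimately show ?thesis using that by blast
qed

section \<open>Diagonal classes and normalizers of the cyclic groups they generate\<close>

lemma pgl_diag_matrix_pow:
  fixes d :: "'a::field ^ 'n"
  assumes "\<And>i. d $ i \<noteq> 0"
  shows "pgl (diag_matrix d) [^]\<^bsub>PGL\<^esub> (k::nat) = pgl (diag_matrix (\<chi> i. d $ i ^ k))"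
proof (induction k)
  case 0
  show ?case by (simp add: PGL_one diag_matrix_1[symmetric])
next
  case (Suc k)
  have "invertible (diag_matrix (\<chi> i. d $ i ^ k))" "invertible (diag_matrix d)"
    using assms by (auto intro: invertible_diag_matrix)
  then show ?case
    using Suc by (simp add: pgl_mult monomial_matrix_mult mult.commute)
qed

lemma pgl_diag_matrix_eq_iff:
  "pgl (diag_matrix u) = pgl (diag_matrix v) \<longleftrightarrow> (\<exists>c. c \<noteq> 0 \<and> (\<forall>i. u $ i = c * v $ i))"
  unfolding pgl_eq_iff by (force simp: monomial_matrix_def)

text \<open>A power that is trivial in the projective group is a scalar matrix, and the entry 1 at
  \<open>i\<^sub>0\<close> forces that scalar to be 1. So the order is the one of the matrix
  itself.\<close>

lemma ord_pgl_diag_matrix: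
  fixes d :: "'a::field ^ 'n"
  assumes "\<And>i. d $ i \<noteq> 0" "d $ i\<^sub>0 = 1" "\<And>k. (\<forall>i. d $ i ^ k = 1) \<longleftrightarrow> n dvd k"
  shows "group.ord PGL (pgl (diag_matrix d)) = n"
proof -
  have "pgl (diag_matrix d) [^]\<^bsub>PGL\<^esub> k = \<one>\<^bsub>PGL\<^esub> \<longleftrightarrow> n dvd k" for k :: nat
  proof -
    have "pgl (diag_matrix d) [^]\<^bsub>PGL\<^esub> k = \<one>\<^bsub>PGL\<^esub> \<longleftrightarrow> (\<exists>c. c \<noteq> 0 \<and> (\<forall>i. d $ i ^ k = c))"
      unfolding pgl_diag_matrix_pow[OF assms(1)] PGL_one diag_matrix_1[symmetric]
        pgl_diag_matrix_eq_iff by simp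
    also have "\<dots> \<longleftrightarrow> (\<forall>i. d $ i ^ k = 1)"
      using assms(2) by (metis power_one one_neq_zero)
    finally show ?thesis using assms(3) by simp
  qed
  then show ?thesis
    using PGL.ord_unique[OF pgl_closed[OF invertible_diag_matrix[OF assms(1)]]] by blast
qed

lemma generate_pgl_diag_matrix:
  fixes d :: "'a::field ^ 'n"
  assumes "\<And>i. d $ i \<noteq> 0" "group.ord PGL (pgl (diag_matrix d)) > 0"
  shows "generate PGL {pgl (diag_matrix d)} = (\<Union>k::nat. {pgl (diag_matrix (\<chi> i. d $ i ^ k))})"
  using PGL.generate_pow_nat[OF pgl_closed[OF invertible_diag_matrix[OF assms(1)]]] assms(2)
  by (auto simp: pgl_diag_matrix_pow[OF assms(1)])

text \<open>The conjugate of the generator must be some \<open>k\<close>-th power of it. Entry by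
  entry this says \<open>M i j * d j = c * (M i j * d i ^ k)\<close>, with \<open>c\<close> the
  scalar lost in the projective group, and it is a condition only where \<open>M i j\<close> is
  nonzero.\<close>

lemma pgl_mem_normalizer_diag_iff:
  fixes d :: "'a::field ^ 'n"
  assumes d: "\<And>i. d $ i \<noteq> 0" and ord: "group.ord PGL (pgl (diag_matrix d)) > 0"
    and M: "invertible M"
  shows "pgl M \<in> normalizer PGL (generate PGL {pgl (diag_matrix d)}) \<longleftrightarrow>
    (\<exists>(k::nat) c. c \<noteq> 0 \<and> (\<forall>i j. M $ i $ j \<noteq> 0 \<longrightarrow> d $ j = c * d $ i ^ k))"
proof -
  let ?g = "pgl (diag_matrix d)"
  have inv: "invertible (diag_matrix d)" using d by (rule invertible_diag_matrix)
  have gc: "?g \<in> carrier PGL" using inv by (rule pgl_closed)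
  have "finite (generate PGL {?g})"
    using PGL.generate_pow_card[OF gc] ord card.infinite by fastforce
  then have "pgl M \<in> normalizer PGL (generate PGL {?g}) \<longleftrightarrow>
      pgl M \<otimes>\<^bsub>PGL\<^esub> ?g \<otimes>\<^bsub>PGL\<^esub> inv\<^bsub>PGL\<^esub> pgl M \<in> generate PGL {?g}"
    using PGL.mem_normalizer_generate_iff[of "{?g}"] gc pgl_closed[OF M] by simp
  also have "\<dots> \<longleftrightarrow> (\<exists>k::nat. pgl M \<otimes>\<^bsub>PGL\<^esub> ?g \<otimes>\<^bsub>PGL\<^esub> inv\<^bsub>PGL\<^esub> pgl M = pgl (diag_matrix (\<chi> i. d $ i ^ k)))"
    unfolding generate_pgl_diag_matrix[OF d ord] by simp
  also have "\<dots> \<longleftrightarrow> (\<exists>k::nat. pgl (M ** diag_matrix d) = pgl (diag_matrix (\<chi> i. d $ i ^ k) ** M))"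
  proof -
    have "invertible (diag_matrix (\<chi> i. d $ i ^ k))" for k :: nat
      using d by (intro invertible_diag_matrix) simp
    then show ?thesis using PGL_conj_eq_iff[OF M inv] by blast
  qed
  also have "\<dots> \<longleftrightarrow> (\<exists>(k::nat) c. c \<noteq> 0 \<and> (\<forall>i j. M $ i $ j \<noteq> 0 \<longrightarrow> d $ j = c * d $ i ^ k))"
  proof -
    have "(M ** diag_matrix d) $ i $ j = M $ i $ j * d $ j" for i j
      by (simp add: matrix_matrix_mult_def monomial_matrix_def if_distrib[of "\<lambda>x. _ * x"] cong: if_cong)
    moreover have "(diag_matrix (\<chi> i. d $ i ^ k) ** M) $ i $ j = M $ i $ j * d $ i ^ k" for i j k
      by (simp add: matrix_matrix_mult_def monomial_matrix_def if_distrib[of "\<lambda>x. x * _"] cong: if_cong)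
    moreover have "a * x = c * (a * y) \<longleftrightarrow> (a \<noteq> 0 \<longrightarrow> x = c * y)" for a x y c :: 'a
      by (auto simp: mult.left_commute[of c])
    ultimately show ?thesis unfolding pgl_eq_iff by simp
  qed
  finally show ?thesis .
qed

text \<open>Two nonzero entries of row \<open>i\<close> in columns \<open>j\<close> and
  \<open>l\<close> give \<open>d j = c * d i ^ k = d l\<close>, hence \<open>j = l\<close> when the
  entries of \<open>d\<close> are distinct.\<close>

lemma normalizer_cyclic_diag:
  fixes d :: "'a::field ^ 'n"
  assumes d: "\<And>i. d $ i \<noteq> 0" and ord: "group.ord PGL (pgl (diag_matrix d)) > 0"
    and inj: "inj (($) d)"
  shows "normalizer PGL (generate PGL {pgl (diag_matrix d)}) =
    {pgl (monomial_matrix \<sigma> u) | \<sigma> u. bij \<sigma> \<and> (\<forall>i. u $ i \<noteq> 0) \<and>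
       (\<exists>(k::nat) c. c \<noteq> 0 \<and> (\<forall>i. d $ \<sigma> i = c * d $ i ^ k))}"
    (is "?N = ?R")
proof
  show "?N \<subseteq> ?R"
  proof
    fix x assume x: "x \<in> ?N"
    then obtain M where M: "x = pgl M" "invertible M"
      using PGL.normalizer_subset_carrier by (auto simp: carrier_PGL)
    obtain k :: nat and c where kc: "c \<noteq> 0" "\<And>i j. M $ i $ j \<noteq> 0 \<Longrightarrow> d $ j = c * d $ i ^ k"
      using x unfolding M pgl_mem_normalizer_diag_iff[OF d ord M(2)] by blast
    have "j = l" if "M $ i $ j \<noteq> 0" "M $ i $ l \<noteq> 0" for i j l
    proof -
      have "d $ j = d $ l" using kc(2)[OF that(1)] kc(2)[OF that(2)] by simp
      then show ?thesis using inj by (auto dest: injD)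
    qed
    then obtain \<sigma> u where \<sigma>u: "bij \<sigma>" "\<And>i. u $ i \<noteq> 0" "M = monomial_matrix \<sigma> u"
      using monomial_matrixI[OF M(2)] by metis
    have "d $ \<sigma> i = c * d $ i ^ k" for i
      using kc(2)[of i "\<sigma> i"] \<sigma>u(2)[of i] unfolding \<sigma>u(3) by (simp add: monomial_matrix_def)
    then show "x \<in> ?R" using M(1) \<sigma>u kc(1) by blast
  qed
  show "?R \<subseteq> ?N"
  proof
    fix x assume "x \<in> ?R"
    then obtain \<sigma> u c and k :: nat where x: "x = pgl (monomial_matrix \<sigma> u)" "bij \<sigma>" "\<And>i. u $ i \<noteq> 0"
      "c \<noteq> 0" "\<And>i. d $ \<sigma> i = c * d $ i ^ k" by blast
    show "x \<in> ?N"
      unfolding x(1) pgl_mem_normalizer_diag_iff[OF d ord invertible_monomial_matrix[OF x(2,3)]]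
      using x(4,5) by (intro exI[of _ k] exI[of _ c]) (simp add: monomial_matrix_def)
  qed
qed

section \<open>Diagonal entries that are powers of a primitive root of unity\<close>

lemma primitive_root_power_eq_1_iff:
  assumes "primitive_root_of_unity n z"
  shows "z ^ m = 1 \<longleftrightarrow> n dvd m"
proof -
  have zn: "z ^ n = 1" "n > 0" and min: "\<And>k. 0 < k \<Longrightarrow> k < n \<Longrightarrow> z ^ k \<noteq> 1"
    using assms by (auto simp: primitive_root_of_unity_def)
  have "z ^ m = z ^ (n * (m div n) + m mod n)" by simp
  also have "\<dots> = z ^ (m mod n)" by (simp only: power_add power_mult zn power_one mult_1)
  finally show ?thesis
    using min[of "m mod n"] zn(2) by (cases "m mod n = 0") (auto simp: dvd_eq_mod_eq_0)
qed

lemma primitive_root_nonzero: "primitive_root_of_unity n z \<Longrightarrow> z \<noteq> 0"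
  by (auto simp: primitive_root_of_unity_def zero_power)

lemma primitive_root_power_eq_iff:
  assumes "primitive_root_of_unity n z"
  shows "z ^ a = z ^ b \<longleftrightarrow> a mod n = b mod n"
proof -
  have *: "z ^ a = z ^ b \<longleftrightarrow> a mod n = b mod n" if "a \<le> b" for a b
  proof -
    have "z ^ b = z ^ a * z ^ (b - a)" using that by (simp flip: power_add)
    then have "z ^ a = z ^ b \<longleftrightarrow> z ^ (b - a) = 1"
      using primitive_root_nonzero[OF assms] by simp
    also have "\<dots> \<longleftrightarrow> b mod n = a mod n"
      using that by (simp add: primitive_root_power_eq_1_iff[OF assms] mod_eq_dvd_iff_nat)
    finally show ?thesis by auto
  qed
  show ?thesis using *[of a b] *[of b a] by (cases "a \<le> b") auto
qed

lemma primitive_root_minus_1: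
  assumes "(- 1 :: 'a::field) \<noteq> 1"
  shows "primitive_root_of_unity 2 (- 1 :: 'a)"
  using assms by (auto simp: primitive_root_of_unity_def less_2_cases_iff)

text \<open>If -1 = 1, then 1 is the only square root of 1, so the square of \<open>z\<close> would
  be 1, against its order 4. This makes -1 a primitive square root of unity, which handles the
  subgroup of order 2.\<close>

lemma primitive_root_4_imp_minus_1_neq_1:
  assumes "primitive_root_of_unity 4 (z :: 'a::field)"
  shows "(- 1 :: 'a) \<noteq> 1"
proof
  assume "(- 1 :: 'a) = 1"
  moreover have "(z\<^sup>2)\<^sup>2 = 1" "z\<^sup>2 \<noteq> 1"
    using primitive_root_power_eq_1_iff[OF assms] by (simp_all flip: power_mult)
  ultimately show False by (metis power2_eq_1_iff)
qed

text \<open>The hypothesis \<open>gen\<close> expresses that the exponents and \<open>n\<close> have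
  no common factor, without asking any single exponent to be a unit modulo \<open>n\<close>. This
  matters for the exponents 2 and 5 modulo 10.\<close>

lemma ord_pgl_diag_matrix_powers:
  fixes z :: "'a::field" and e :: "'n::finite \<Rightarrow> nat"
  assumes z: "primitive_root_of_unity n z" and e: "e i\<^sub>0 = 0"
    and gen: "\<And>k. \<forall>i. n dvd e i * k \<Longrightarrow> n dvd k"
  shows "group.ord PGL (pgl (diag_matrix (\<chi> i. z ^ e i))) = n"
proof (rule ord_pgl_diag_matrix[where i\<^sub>0 = i\<^sub>0])
  fix k
  have "(\<chi> i. z ^ e i) $ i ^ k = 1 \<longleftrightarrow> n dvd e i * k" for i
    by (simp only: vec_lambda_beta power_mult[symmetric] primitive_root_power_eq_1_iff[OF z])
  then show "(\<forall>i. (\<chi> i. z ^ e i) $ i ^ k = 1) \<longleftrightarrow> n dvd k"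
    using gen[of k] dvd_mult by blast
qed (simp_all add: e primitive_root_nonzero[OF z])

text \<open>A permutation matrix normalizes the group generated by \<open>diag (z ^ e i)\<close> iff it acts on
  the exponents as an affine map \<open>x \<mapsto> c + k x\<close> modulo \<open>n\<close>. The constant \<open>c\<close> is the value at the
  index \<open>i\<^sub>0\<close>, whose exponent is normalized to \<open>0\<close>.\<close>

lemma normalizer_cyclic_powers:
  fixes z :: "'a::field" and e :: "'n::finite \<Rightarrow> nat"
  assumes z: "primitive_root_of_unity n z" and e: "e i\<^sub>0 = 0"
    and gen: "\<And>k. \<forall>i. n dvd e i * k \<Longrightarrow> n dvd k"
    and inj: "inj (\<lambda>i. e i mod n)"
  shows "normalizer PGL (generate PGL {pgl (diag_matrix (\<chi> i. z ^ e i))}) =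
    {pgl (monomial_matrix \<sigma> u) | \<sigma> u. bij \<sigma> \<and> (\<forall>i. u $ i \<noteq> 0) \<and>
       (\<exists>k. \<forall>i. e (\<sigma> i) mod n = (e (\<sigma> i\<^sub>0) + e i * k) mod n)}"
proof -
  have "(\<exists>(k::nat) c. c \<noteq> 0 \<and> (\<forall>i. z ^ e (\<sigma> i) = c * (z ^ e i) ^ k)) \<longleftrightarrow>
      (\<exists>k. \<forall>i. e (\<sigma> i) mod n = (e (\<sigma> i\<^sub>0) + e i * k) mod n)" (is "?L = ?R") for \<sigma>
  proof -
    have "?L \<longleftrightarrow> (\<exists>k. \<forall>i. z ^ e (\<sigma> i) = z ^ e (\<sigma> i\<^sub>0) * (z ^ e i) ^ k)"
    proof
      assume ?L
      then obtain k c where kc: "\<And>i. z ^ e (\<sigma> i) = c * (z ^ e i) ^ k" by blast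
      then have "c = z ^ e (\<sigma> i\<^sub>0)" using e by simp
      with kc show "\<exists>k. \<forall>i. z ^ e (\<sigma> i) = z ^ e (\<sigma> i\<^sub>0) * (z ^ e i) ^ k" by blast
    next
      assume "\<exists>k. \<forall>i. z ^ e (\<sigma> i) = z ^ e (\<sigma> i\<^sub>0) * (z ^ e i) ^ k"
      moreover have "z ^ e (\<sigma> i\<^sub>0) \<noteq> 0" using primitive_root_nonzero[OF z] by simp
      ultimately show ?L by blast
    qed
    also have "\<dots> \<longleftrightarrow> ?R"
      by (simp only: power_mult[symmetric] power_add[symmetric] primitive_root_power_eq_iff[OF z])
    finally show ?thesis .
  qed
  note iff = this
  show ?thesis
  proof (subst normalizer_cyclic_diag)
    show "group.ord PGL (pgl (diag_matrix (\<chi> i. z ^ e i))) > 0"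
      using ord_pgl_diag_matrix_powers[of n z e i\<^sub>0, OF z e gen] z by (simp add: primitive_root_of_unity_def)
    show "inj (($) (\<chi> i. z ^ e i))"
      using inj by (simp add: inj_def primitive_root_power_eq_iff[OF z])
  qed (use iff primitive_root_nonzero[OF z] in auto)
qed

subsection \<open>Monomial elements of the projective group of the plane\<close>

text \<open>One encoding serves for permutations of the three coordinates and for tuples of
  exponents, so that composites of the two evaluate by rewriting.\<close>

definition triple :: "'b \<Rightarrow> 'b \<Rightarrow> 'b \<Rightarrow> 3 \<Rightarrow> 'b" where
  "triple x y z i = (if i = 1 then x else if i = 2 then y else z)"

lemma triple_simps [simp]: "triple x y z 1 = x" "triple x y z 2 = y" "triple x y z 3 = z"
  by (simp_all add: triple_def)

lemma eq_triple_iff: "f = triple x y z \<longleftrightarrow> f 1 = x \<and> f 2 = y \<and> f 3 = z"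
  by (simp add: fun_eq_iff forall_3)

lemma bij_triple_iff:
  "bij (triple x y z :: 3 \<Rightarrow> 3) \<longleftrightarrow> x \<noteq> y \<and> y \<noteq> z \<and> x \<noteq> z"
proof -
  have "bij (triple x y z :: 3 \<Rightarrow> 3) \<longleftrightarrow> inj (triple x y z)"
    using finite_UNIV_inj_surj[of "triple x y z"] by (auto simp: bij_def)
  then show ?thesis by (auto simp: inj_def forall_3)
qed

lemma bij_3_cases:
  assumes "bij (\<sigma> :: 3 \<Rightarrow> 3)"
  shows "\<sigma> = triple 1 2 3 \<or> \<sigma> = triple 1 3 2 \<or> \<sigma> = triple 2 1 3 \<or> \<sigma> = triple 2 3 1 \<or>
    \<sigma> = triple 3 1 2 \<or> \<sigma> = triple 3 2 1"
proof -
  have "\<sigma> = triple (\<sigma> 1) (\<sigma> 2) (\<sigma> 3)" by (simp add: eq_triple_iff)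
  moreover from this have "\<sigma> 1 \<noteq> \<sigma> 2 \<and> \<sigma> 2 \<noteq> \<sigma> 3 \<and> \<sigma> 1 \<noteq> \<sigma> 3"
    using assms bij_triple_iff by metis
  ultimately show ?thesis
    using exhaust_3[of "\<sigma> 1"] exhaust_3[of "\<sigma> 2"] exhaust_3[of "\<sigma> 3"] by auto
qed

lemma triple_id: "triple 1 2 3 = (\<lambda>i. i)"
  by (simp add: fun_eq_iff forall_3)

lemma proj_map_eq_pgl: "\<lbrakk>L1 : L2 : L3\<rbrakk> = pgl (vector [L1, L2, L3])"
  by (simp add: proj_map_def pgl_def)

lemmas var_defs = varX_def varY_def varZ_def axis_def

lemma proj_map_diag:
  "\<lbrakk>a *s \<X> : b *s \<Y> : c *s \<Z>\<rbrakk> = pgl (diag_matrix (vector [a, b, c]))"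
  unfolding proj_map_eq_pgl
  by (rule arg_cong[of _ _ pgl]) (simp add: vec_eq_iff forall_3 monomial_matrix_def var_defs)

lemma diagonal_subgroup_eq:
  "diagonal_subgroup = {pgl (diag_matrix u) | u :: 'a::field ^ 3. \<forall>i. u $ i \<noteq> 0}"
proof -
  have "(\<forall>i. (vector [a, b, c] :: 'a ^ 3) $ i \<noteq> 0) \<longleftrightarrow> a \<noteq> 0 \<and> b \<noteq> 0 \<and> c \<noteq> 0" for a b c :: 'a
    by (simp add: forall_3)
  moreover have "u = vector [u $ 1, u $ 2, u $ 3]" for u :: "'a ^ 3"
    by (simp add: vec_eq_iff forall_3)
  ultimately show ?thesis
    unfolding diagonal_subgroup_def proj_map_diag by (intro equalityI subsetI; clarsimp; metis)
qed

text \<open>The repeated entry 1 makes \<open>normalizer_cyclic_diag\<close> inapplicable. The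
  generator is a homology with centre (0:0:1) and axis Z = 0, and a normalizing class has to
  preserve both; the proof extracts this from the zero pattern of \<open>M\<close>.\<close>

lemma normalizer_homology:
  fixes z :: "'a::field"
  assumes z: "primitive_root_of_unity n z" and n: "n > 1"
  shows "normalizer PGL3 (generate PGL3 {pgl (diag_matrix (\<chi> i. z ^ triple 0 0 1 i))}) = GL2_Z"
    (is "?N = _")
proof -
  let ?d = "(\<chi> i. z ^ triple 0 0 1 i) :: 'a ^ 3"
  have z1: "z \<noteq> 1" using primitive_root_power_eq_1_iff[OF z, of 1] n by auto
  have d: "?d $ i \<noteq> 0" for i using primitive_root_nonzero[OF z] by simp
  have ord: "group.ord PGL (pgl (diag_matrix ?d)) > 0"
    using ord_pgl_diag_matrix_powers[OF z, of "triple 0 0 1" 1] n by (force simp: forall_3)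
  show ?thesis
  proof
    show "?N \<subseteq> GL2_Z"
    proof
      fix x assume x: "x \<in> ?N"
      then obtain M where M: "x = pgl M" "invertible M"
        using PGL.normalizer_subset_carrier by (auto simp: carrier_PGL)
      obtain k :: nat and c where c: "c \<noteq> 0"
        and kc: "\<And>i j. M $ i $ j \<noteq> 0 \<Longrightarrow> ?d $ j = c * ?d $ i ^ k"
        using x unfolding M pgl_mem_normalizer_diag_iff[OF d ord M(2)] by blast
      have det: "det M \<noteq> 0" using M(2) by (simp add: invertible_det_nz)
      \<comment> \<open>A nonzero entry here forces \<open>c = z\<close>, while a nonzero entry in
        the upper left block needs \<open>c = 1\<close>. So the block would vanish and the first two
        rows would be proportional.\<close>
      have top: "M $ i $ 3 = 0" if "i = 1 \<or> i = 2" for i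
      proof (rule ccontr)
        assume "M $ i $ 3 \<noteq> 0"
        then have "c = z" using kc[of i 3] that by auto
        then have "M $ 1 $ 1 = 0" "M $ 1 $ 2 = 0" "M $ 2 $ 1 = 0" "M $ 2 $ 2 = 0"
          using kc[of 1 1] kc[of 1 2] kc[of 2 1] kc[of 2 2] z1 by auto
        then show False using det by (simp add: det_3)
      qed
      then have det': "(M $ 1 $ 1 * M $ 2 $ 2 - M $ 1 $ 2 * M $ 2 $ 1) * M $ 3 $ 3 \<noteq> 0"
        using det by (simp add: det_3 algebra_simps)
      then have m33: "M $ 3 $ 3 \<noteq> 0" by auto
      \<comment> \<open>The first row has a nonzero entry in one of its first two columns, and both
        the row and the column there carry the diagonal entry 1.\<close>
      have "c = 1"
      proof (cases "M $ 1 $ 1 = 0")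
        case True
        then have "M $ 1 $ 2 \<noteq> 0" using det' by auto
        then show ?thesis using kc[of 1 2] by simp
      qed (use kc[of 1 1] in simp)
      \<comment> \<open>The corner entry gives \<open>z = z ^ k\<close>; a further nonzero entry in
        the last row would give \<open>1 = z ^ k\<close>.\<close>
      then have "z ^ k = z" using kc[OF m33] by simp
      then have bottom: "M $ 3 $ 1 = 0" "M $ 3 $ 2 = 0"
        using kc[of 3 1] kc[of 3 2] z1 \<open>c = 1\<close> by auto
      \<comment> \<open>Dividing by the corner entry selects the representative in which the last
        form is exactly Z.\<close>
      define p q r s where pqrs: "p = M $ 1 $ 1 / M $ 3 $ 3" "q = M $ 1 $ 2 / M $ 3 $ 3"
        "r = M $ 2 $ 1 / M $ 3 $ 3" "s = M $ 2 $ 2 / M $ 3 $ 3"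
      have "x = \<lbrakk>p *s \<X> + q *s \<Y> : r *s \<X> + s *s \<Y> : \<Z>\<rbrakk>"
        unfolding M(1) proj_map_eq_pgl pgl_eq_iff
        using m33 top bottom
        by (intro exI[of _ "M $ 3 $ 3"]) (simp add: forall_3 var_defs pqrs)
      moreover have "p * s - q * r \<noteq> 0"
        using det' m33 by (simp add: pqrs field_simps)
      ultimately show "x \<in> GL2_Z" unfolding GL2_Z_def by blast
    qed
    show "GL2_Z \<subseteq> ?N"
    proof
      fix x assume "x \<in> (GL2_Z :: ('a ^ 3 ^ 3) set set)"
      then obtain p q r s where x: "x = \<lbrakk>p *s \<X> + q *s \<Y> : r *s \<X> + s *s \<Y> : \<Z>\<rbrakk>"
        and det: "p * s - q * r \<noteq> (0 :: 'a)" unfolding GL2_Z_def by blast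
      let ?M = "vector [p *s \<X> + q *s \<Y>, r *s \<X> + s *s \<Y>, \<Z>] :: 'a ^ 3 ^ 3"
      have inv: "invertible ?M" using det by (simp add: invertible_det_nz det_3 var_defs)
      show "x \<in> ?N"
        unfolding x proj_map_eq_pgl pgl_mem_normalizer_diag_iff[OF d ord inv]
        \<comment> \<open>Here \<open>k = 1\<close> and \<open>c = 1\<close>: block matrices of this
          shape commute with the homology.\<close>
        by (intro exI[of _ 1]) (simp add: forall_3 var_defs)
    qed
  qed
qed

section \<open>Monomial classes as products of diagonal and permutation classes\<close>

abbreviation ones :: "'a::field ^ 'n" where
  "ones \<equiv> (\<chi> i. 1)"

text \<open>Scaling does not change which entries vanish, so a monomial class determines its
  permutation.\<close>

lemma pgl_monomial_eq_iff:
  fixes u :: "'a::field ^ 'n"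
  assumes "\<And>i. u $ i \<noteq> 0"
  shows "pgl (monomial_matrix \<sigma> u) = pgl (monomial_matrix \<tau> v) \<longleftrightarrow>
    \<sigma> = \<tau> \<and> (\<exists>c. c \<noteq> 0 \<and> (\<forall>i. u $ i = c * v $ i))"
proof
  assume "pgl (monomial_matrix \<sigma> u) = pgl (monomial_matrix \<tau> v)"
  then obtain c where c: "c \<noteq> 0"
    "\<And>i j. (if j = \<sigma> i then u $ i else 0) = c * (if j = \<tau> i then v $ i else 0)"
    unfolding pgl_eq_iff monomial_matrix_def by auto
  have eq: "\<sigma> i = \<tau> i" for i
    using c(2)[of "\<sigma> i" i] assms[of i] by (auto split: if_splits)
  then have "u $ i = c * v $ i" for i using c(2)[of "\<sigma> i" i] by simp
  then show "\<sigma> = \<tau> \<and> (\<exists>c. c \<noteq> 0 \<and> (\<forall>i. u $ i = c * v $ i))" using eq c(1) by blast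
next
  assume "\<sigma> = \<tau> \<and> (\<exists>c. c \<noteq> 0 \<and> (\<forall>i. u $ i = c * v $ i))"
  then show "pgl (monomial_matrix \<sigma> u) = pgl (monomial_matrix \<tau> v)"
    unfolding pgl_eq_iff by (auto simp: monomial_matrix_def)
qed

lemma pgl_monomial_mult:
  assumes "bij \<sigma>" "\<And>i. u $ i \<noteq> 0" "bij \<tau>" "\<And>i. v $ i \<noteq> 0"
  shows "pgl (monomial_matrix \<sigma> u) \<otimes>\<^bsub>PGL\<^esub> pgl (monomial_matrix \<tau> v) =
    pgl (monomial_matrix (\<lambda>i. \<tau> (\<sigma> i)) (\<chi> i. u $ i * v $ \<sigma> i))"
  using assms by (simp add: pgl_mult invertible_monomial_matrix monomial_matrix_mult)

lemma bij_id_fun: "bij (\<lambda>i. i)"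
  by (simp add: bij_def)

lemma pgl_monomial_decomp:
  assumes "bij \<sigma>" "\<And>i. u $ i \<noteq> 0"
  shows "pgl (monomial_matrix \<sigma> u) = pgl (diag_matrix u) \<otimes>\<^bsub>PGL\<^esub> pgl (monomial_matrix \<sigma> ones)"
  using assms by (simp add: pgl_monomial_mult bij_id_fun)

lemma pgl_monomial_ones_mult:
  assumes "bij \<sigma>" "bij \<tau>"
  shows "pgl (monomial_matrix \<sigma> ones) \<otimes>\<^bsub>PGL\<^esub> pgl (monomial_matrix \<tau> ones) =
    pgl (monomial_matrix (\<lambda>i. \<tau> (\<sigma> i)) ones)"
  using assms by (simp add: pgl_monomial_mult)

text \<open>Every monomial class is a diagonal class times a permutation class. Once all diagonal
  factors are allowed, it remains to produce the permutation classes from the extra generators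
  \<open>P\<close>.\<close>

lemma monomial_group_eq_generate:
  assumes sub: "subgroup N PGL3"
    and N: "N = {pgl (monomial_matrix \<sigma> u) | \<sigma> u. \<sigma> \<in> \<Sigma> \<and> (\<forall>i. u $ i \<noteq> 0)}"
    and bij: "\<And>\<sigma>. \<sigma> \<in> \<Sigma> \<Longrightarrow> bij \<sigma>" and id: "(\<lambda>i. i) \<in> \<Sigma>"
    and P: "P \<subseteq> N"
    and gen: "\<And>\<sigma>. \<sigma> \<in> \<Sigma> \<Longrightarrow> pgl (monomial_matrix \<sigma> ones) \<in> generate PGL3 (diagonal_subgroup \<union> P)"
  shows "N = generate PGL3 (diagonal_subgroup \<union> P)"
proof
  have D: "diagonal_subgroup \<subseteq> N" unfolding N diagonal_subgroup_eq using id by blast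
  then show "generate PGL3 (diagonal_subgroup \<union> P) \<subseteq> N"
    using PGL.generate_subgroup_incl[OF _ sub] P by blast
  show "N \<subseteq> generate PGL3 (diagonal_subgroup \<union> P)"
  proof
    fix x assume "x \<in> N"
    then obtain \<sigma> u where x: "x = pgl (monomial_matrix \<sigma> u)" "\<sigma> \<in> \<Sigma>" "\<And>i. u $ i \<noteq> 0"
      unfolding N by blast
    have "pgl (diag_matrix u) \<in> generate PGL3 (diagonal_subgroup \<union> P)"
      using x(3) by (intro generate.incl) (auto simp: diagonal_subgroup_eq)
    then show "x \<in> generate PGL3 (diagonal_subgroup \<union> P)"
      unfolding x(1) pgl_monomial_decomp[OF bij[OF x(2)] x(3)]
      using gen[OF x(2)] by (rule generate.eng)
  qed
qed

lemma proj_map_perms: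
  "\<lbrakk>\<X> : \<Z> : \<Y>\<rbrakk> = pgl (monomial_matrix (triple 1 3 2) ones)"
  "\<lbrakk>\<Z> : \<X> : \<Y>\<rbrakk> = pgl (monomial_matrix (triple 3 1 2) ones)"
  "\<lbrakk>\<Z> : \<Y> : \<X>\<rbrakk> = pgl (monomial_matrix (triple 3 2 1) ones)"
  unfolding proj_map_eq_pgl
  by (rule arg_cong[of _ _ pgl], simp add: vec_eq_iff forall_3 monomial_matrix_def var_defs)+

lemma proj_map_diag_powers:
  "\<lbrakk>\<X> : z ^ a *s \<Y> : z ^ b *s \<Z>\<rbrakk> = pgl (diag_matrix (\<chi> i. z ^ triple 0 a b i))"
  unfolding proj_map_eq_pgl
  by (rule arg_cong[of _ _ pgl]) (simp add: vec_eq_iff forall_3 monomial_matrix_def var_defs)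

lemma T_X_eq: "T_X = {pgl (diag_matrix (vector [a, 1, 1])) | a :: 'a::field. a \<noteq> 0}"
proof -
  have "\<lbrakk>a *s \<X> : \<Y> : \<Z>\<rbrakk> = pgl (diag_matrix (vector [a, 1, 1]))" for a :: 'a
    using proj_map_diag[of a 1 1] by simp
  then show ?thesis by (simp add: T_X_def)
qed

section \<open>Cyclic diagonal groups acting on the plane\<close>

lemma ord_diag_powers_3:
  assumes z: "primitive_root_of_unity n z"
    and gen: "\<forall>k. n dvd a * k \<longrightarrow> n dvd b * k \<longrightarrow> n dvd k"
  shows "group.ord PGL3 (pgl (diag_matrix (\<chi> i. z ^ triple 0 a b i))) = n"
proof (rule ord_pgl_diag_matrix_powers[where i\<^sub>0 = 1])
  show "n dvd k" if "\<forall>i. n dvd triple 0 a b i * k" for k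
    using that spec[OF gen, of k] by (simp add: forall_3)
qed (use z in auto)

lemma cyclic_diag_3_iso:
  assumes z: "primitive_root_of_unity n z"
    and gen: "\<forall>k. n dvd a * k \<longrightarrow> n dvd b * k \<longrightarrow> n dvd k"
  shows "PGL3\<lparr>carrier := generate PGL3 {pgl (diag_matrix (\<chi> i. z ^ triple 0 a b i))}\<rparr>
    \<cong> integer_mod_group n"
proof (rule PGL.cyclic_iso_integer_mod_group)
  show "pgl (diag_matrix (\<chi> i. z ^ triple 0 a b i)) \<in> carrier PGL3"
    using primitive_root_nonzero[OF z] by (intro pgl_closed invertible_diag_matrix) simp
qed (use z ord_diag_powers_3[OF z gen] in \<open>auto simp: primitive_root_of_unity_def\<close>)

text \<open>The last hypothesis isolates the arithmetic: \<open>\<Sigma>\<close> is the set of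
  permutations acting affinely on the exponents 0, \<open>a\<close>, \<open>b\<close>, to be
  determined for each modulus separately.\<close>

lemma normalizer_cyclic_diag_3:
  assumes z: "primitive_root_of_unity n z"
    and gen: "\<forall>k. n dvd a * k \<longrightarrow> n dvd b * k \<longrightarrow> n dvd k"
    and distinct: "distinct [0, a mod n, b mod n]"
    and \<Sigma>: "\<And>\<sigma>. bij \<sigma> \<and> (\<exists>k. \<forall>i. triple 0 a b (\<sigma> i) mod n =
        (triple 0 a b (\<sigma> 1) + triple 0 a b i * k) mod n) \<longleftrightarrow> \<sigma> \<in> \<Sigma>"
  shows "normalizer PGL3 (generate PGL3 {pgl (diag_matrix (\<chi> i. z ^ triple 0 a b i))}) =
    {pgl (monomial_matrix \<sigma> u) | \<sigma> u. \<sigma> \<in> \<Sigma> \<and> (\<forall>i. u $ i \<noteq> 0)}"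
proof (subst normalizer_cyclic_powers[where i\<^sub>0 = 1, OF z])
  show "n dvd k" if "\<forall>i. n dvd triple 0 a b i * k" for k
    using that spec[OF gen, of k] by (simp add: forall_3)
  show "inj (\<lambda>i. triple 0 a b i mod n)"
    using distinct by (simp add: inj_def forall_3)
qed (simp_all only: \<Sigma>[symmetric] conj_ac triple_simps)

lemma subgroup_normalizer_diag_3:
  assumes z: "primitive_root_of_unity n z"
  shows "subgroup (normalizer PGL3 (generate PGL3 {pgl (diag_matrix (\<chi> i. z ^ triple 0 a b i))})) PGL3"
proof -
  have "pgl (diag_matrix (\<chi> i. z ^ triple 0 a b i)) \<in> carrier PGL3"
    using primitive_root_nonzero[OF z] by (intro pgl_closed invertible_diag_matrix) simp
  then show ?thesis by (intro PGL.normalizer_imp_subgroup PGL.generate_incl) simp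
qed

lemma normalizer_cyclic_reversal:
  assumes z: "primitive_root_of_unity n z"
    and gen: "\<forall>k. n dvd a * k \<longrightarrow> n dvd b * k \<longrightarrow> n dvd k"
    and distinct: "distinct [0, a mod n, b mod n]"
    and \<Sigma>: "\<And>\<sigma>. bij \<sigma> \<and> (\<exists>k. \<forall>i. triple 0 a b (\<sigma> i) mod n =
        (triple 0 a b (\<sigma> 1) + triple 0 a b i * k) mod n) \<longleftrightarrow> \<sigma> \<in> {\<lambda>i. i, triple 3 2 1}"
  shows "normalizer PGL3 (generate PGL3 {pgl (diag_matrix (\<chi> i. z ^ triple 0 a b i))}) =
    generate PGL3 (diagonal_subgroup \<union> {\<lbrakk>\<Z> : \<Y> : \<X>\<rbrakk>})"
proof (rule monomial_group_eq_generate[OF subgroup_normalizer_diag_3[OF z]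
      normalizer_cyclic_diag_3[OF z gen distinct \<Sigma>]])
  show "{\<lbrakk>\<Z> : \<Y> : \<X>\<rbrakk>} \<subseteq> normalizer PGL3 (generate PGL3 {pgl (diag_matrix (\<chi> i. z ^ triple 0 a b i))})"
    unfolding normalizer_cyclic_diag_3[OF z gen distinct \<Sigma>] proj_map_perms by fastforce
  show "pgl (monomial_matrix \<sigma> ones) \<in> generate PGL3 (diagonal_subgroup \<union> {\<lbrakk>\<Z> : \<Y> : \<X>\<rbrakk>})"
    if "\<sigma> \<in> {\<lambda>i. i, triple 3 2 1}" for \<sigma>
  proof -
    have "pgl (diag_matrix ones) \<in> generate PGL3 (diagonal_subgroup \<union> {\<lbrakk>\<Z> : \<Y> : \<X>\<rbrakk>})"
      by (rule generate.incl) (force simp: diagonal_subgroup_eq)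
    moreover have "\<lbrakk>\<Z> : \<Y> : \<X>\<rbrakk> \<in> generate PGL3 (diagonal_subgroup \<union> {\<lbrakk>\<Z> : \<Y> : \<X>\<rbrakk>})"
      by (rule generate.incl) simp
    ultimately show ?thesis using that by (auto simp: proj_map_perms)
  qed
qed (auto simp: bij_id_fun bij_triple_iff)

lemma normalizer_cyclic_identity:
  assumes z: "primitive_root_of_unity n z"
    and gen: "\<forall>k. n dvd a * k \<longrightarrow> n dvd b * k \<longrightarrow> n dvd k"
    and distinct: "distinct [0, a mod n, b mod n]"
    and \<Sigma>: "\<And>\<sigma>. bij \<sigma> \<and> (\<exists>k. \<forall>i. triple 0 a b (\<sigma> i) mod n =
        (triple 0 a b (\<sigma> 1) + triple 0 a b i * k) mod n) \<longleftrightarrow> \<sigma> \<in> {\<lambda>i. i}"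
  shows "normalizer PGL3 (generate PGL3 {pgl (diag_matrix (\<chi> i. z ^ triple 0 a b i))}) =
    diagonal_subgroup"
  unfolding normalizer_cyclic_diag_3[OF z gen distinct \<Sigma>] diagonal_subgroup_eq by blast

section \<open>Permutations acting affinely on the exponents, with multipliers taken as
  residues\<close>

lemma add_mult_mod_right: "(x + c * (k mod n)) mod n = (x + c * k) mod (n::nat)"
  by (metis mod_add_right_eq mod_mult_right_eq)

text \<open>Affine maps keep differences even, and 0, 2 is the only pair of exponents with even
  difference. So this pair is preserved and 1 is fixed. The proof checks the residues of the
  multiplier one by one.\<close>

lemma affine_exponent_permutations_mod_4:
  "bij \<sigma> \<and> (\<exists>k. \<forall>i. triple 0 1 2 (\<sigma> i) mod 4 =
    (triple 0 1 2 (\<sigma> 1) + triple 0 1 2 i * k) mod (4::nat)) \<longleftrightarrow> \<sigma> \<in> {\<lambda>i. i, triple 3 2 1}" (is "?L \<longleftrightarrow> _")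
proof
  assume L: ?L
  then obtain k where k: "\<And>i. triple 0 1 2 (\<sigma> i) mod 4 =
    (triple 0 1 2 (\<sigma> 1) + triple 0 1 2 i * k) mod (4::nat)" by blast
  define l where "l = k mod 4"
  have l: "l = 0 \<or> l = 1 \<or> l = 2 \<or> l = 3" unfolding l_def by presburger
  have eqs: "triple 0 1 2 (\<sigma> 2) mod 4 = (triple 0 1 2 (\<sigma> 1) + 1 * l) mod 4"
    "triple 0 1 2 (\<sigma> 3) mod 4 = (triple 0 1 2 (\<sigma> 1) + 2 * l) mod 4"
    using k[of 2] k[of 3] by (simp_all only: triple_simps l_def add_mult_mod_right)
  have "\<sigma> \<noteq> triple 1 3 2" "\<sigma> \<noteq> triple 2 1 3" "\<sigma> \<noteq> triple 2 3 1" "\<sigma> \<noteq> triple 3 1 2"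
    by (rule notI, use l eqs in \<open>elim disjE; simp\<close>)+
  then have "\<sigma> \<in> {triple 1 2 3, triple 3 2 1}"
    using bij_3_cases[OF conjunct1[OF L]] by blast
  then show "\<sigma> \<in> {\<lambda>i. i, triple 3 2 1}" by (simp only: triple_id)
next
  assume "\<sigma> \<in> {\<lambda>i. i, triple 3 2 1}"
  then consider "\<sigma> = triple 1 2 3" | "\<sigma> = triple 3 2 1"
    unfolding triple_id by blast
  then show ?L
  proof cases
    case 1
    then show ?thesis by (intro conjI exI[of _ 1]) (simp_all add: bij_triple_iff forall_3)
  next
    case 2
    \<comment> \<open>The reversal is \<open>2 + 3 * x\<close> modulo 4, that is,
      \<open>2 - x\<close>.\<close>
    then show ?thesis by (intro conjI exI[of _ 3]) (simp_all add: bij_triple_iff forall_3)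
  qed
qed

text \<open>Again only one pair, 0 and 4, has even difference, so 1 is fixed.\<close>

lemma affine_exponent_permutations_mod_8:
  "bij \<sigma> \<and> (\<exists>k. \<forall>i. triple 0 1 4 (\<sigma> i) mod 8 =
    (triple 0 1 4 (\<sigma> 1) + triple 0 1 4 i * k) mod (8::nat)) \<longleftrightarrow> \<sigma> \<in> {\<lambda>i. i, triple 3 2 1}" (is "?L \<longleftrightarrow> _")
proof
  assume L: ?L
  then obtain k where k: "\<And>i. triple 0 1 4 (\<sigma> i) mod 8 =
    (triple 0 1 4 (\<sigma> 1) + triple 0 1 4 i * k) mod (8::nat)" by blast
  define l where "l = k mod 8"
  have l: "l = 0 \<or> l = 1 \<or> l = 2 \<or> l = 3 \<or> l = 4 \<or> l = 5 \<or> l = 6 \<or> l = 7" unfolding l_def by presburger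
  have eqs: "triple 0 1 4 (\<sigma> 2) mod 8 = (triple 0 1 4 (\<sigma> 1) + 1 * l) mod 8"
    "triple 0 1 4 (\<sigma> 3) mod 8 = (triple 0 1 4 (\<sigma> 1) + 4 * l) mod 8"
    using k[of 2] k[of 3] by (simp_all only: triple_simps l_def add_mult_mod_right)
  have "\<sigma> \<noteq> triple 1 3 2" "\<sigma> \<noteq> triple 2 1 3" "\<sigma> \<noteq> triple 2 3 1" "\<sigma> \<noteq> triple 3 1 2"
    by (rule notI, use l eqs in \<open>elim disjE; simp\<close>)+
  then have "\<sigma> \<in> {triple 1 2 3, triple 3 2 1}"
    using bij_3_cases[OF conjunct1[OF L]] by blast
  then show "\<sigma> \<in> {\<lambda>i. i, triple 3 2 1}" by (simp only: triple_id)
next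
  assume "\<sigma> \<in> {\<lambda>i. i, triple 3 2 1}"
  then consider "\<sigma> = triple 1 2 3" | "\<sigma> = triple 3 2 1"
    unfolding triple_id by blast
  then show ?L
  proof cases
    case 1
    then show ?thesis by (intro conjI exI[of _ 1]) (simp_all add: bij_triple_iff forall_3)
  next
    case 2
    \<comment> \<open>Modulo 8 the map \<open>4 + 5 * x\<close> exchanges 0 and 4 and fixes
      1.\<close>
    then show ?thesis by (intro conjI exI[of _ 5]) (simp_all add: bij_triple_iff forall_3)
  qed
qed

text \<open>The pair 0, 2 is the only one with even difference and 0, 5 the only one whose
  difference is divisible by 5. Both pairs are preserved, hence so is their common element 0, and
  nothing moves.\<close>

lemma affine_exponent_permutations_mod_10:
  "bij \<sigma> \<and> (\<exists>k. \<forall>i. triple 0 2 5 (\<sigma> i) mod 10 =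
    (triple 0 2 5 (\<sigma> 1) + triple 0 2 5 i * k) mod (10::nat)) \<longleftrightarrow> \<sigma> \<in> {\<lambda>i. i}" (is "?L \<longleftrightarrow> _")
proof
  assume L: ?L
  then obtain k where k: "\<And>i. triple 0 2 5 (\<sigma> i) mod 10 =
    (triple 0 2 5 (\<sigma> 1) + triple 0 2 5 i * k) mod (10::nat)" by blast
  define l where "l = k mod 10"
  have l: "l = 0 \<or> l = 1 \<or> l = 2 \<or> l = 3 \<or> l = 4 \<or> l = 5 \<or> l = 6 \<or> l = 7 \<or> l = 8 \<or> l = 9" unfolding l_def by presburger
  have eqs: "triple 0 2 5 (\<sigma> 2) mod 10 = (triple 0 2 5 (\<sigma> 1) + 2 * l) mod 10"
    "triple 0 2 5 (\<sigma> 3) mod 10 = (triple 0 2 5 (\<sigma> 1) + 5 * l) mod 10"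
    using k[of 2] k[of 3] by (simp_all only: triple_simps l_def add_mult_mod_right)
  have "\<sigma> \<noteq> triple 1 3 2" "\<sigma> \<noteq> triple 2 1 3" "\<sigma> \<noteq> triple 2 3 1" "\<sigma> \<noteq> triple 3 1 2" "\<sigma> \<noteq> triple 3 2 1"
    by (rule notI, use l eqs in \<open>elim disjE; simp\<close>)+
  then have "\<sigma> \<in> {triple 1 2 3}"
    using bij_3_cases[OF conjunct1[OF L]] by blast
  then show "\<sigma> \<in> {\<lambda>i. i}" by (simp only: triple_id)
next
  assume "\<sigma> \<in> {\<lambda>i. i}"
  then consider "\<sigma> = triple 1 2 3"
    unfolding triple_id by blast
  then show ?L
  proof cases
    case 1
    then show ?thesis by (intro conjI exI[of _ 1]) (simp_all add: bij_triple_iff forall_3)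
  qed
qed

text \<open>The exponents are all residues modulo 3, and the six affine bijections are all six
  permutations: multiplier 1 for the cyclic shifts, 2 for the transpositions.\<close>

lemma affine_exponent_permutations_mod_3:
  "bij \<sigma> \<and> (\<exists>k. \<forall>i. triple 0 1 2 (\<sigma> i) mod 3 =
    (triple 0 1 2 (\<sigma> 1) + triple 0 1 2 i * k) mod (3::nat)) \<longleftrightarrow> \<sigma> \<in> Collect bij"
proof -
  have "\<exists>k. \<forall>i. triple 0 1 2 (\<sigma> i) mod 3 = (triple 0 1 2 (\<sigma> 1) + triple 0 1 2 i * k) mod (3::nat)"
    if "bij \<sigma>"
    using bij_3_cases[OF that]
  proof (elim disjE)
    assume "\<sigma> = triple 1 2 3"
    then show ?thesis by (intro exI[of _ 1]) (simp add: forall_3)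
  next
    assume "\<sigma> = triple 1 3 2"
    then show ?thesis by (intro exI[of _ 2]) (simp add: forall_3)
  next
    assume "\<sigma> = triple 2 1 3"
    then show ?thesis by (intro exI[of _ 2]) (simp add: forall_3)
  next
    assume "\<sigma> = triple 2 3 1"
    then show ?thesis by (intro exI[of _ 1]) (simp add: forall_3)
  next
    assume "\<sigma> = triple 3 1 2"
    then show ?thesis by (intro exI[of _ 1]) (simp add: forall_3)
  next
    assume "\<sigma> = triple 3 2 1"
    then show ?thesis by (intro exI[of _ 2]) (simp add: forall_3)
  qed
  then show ?thesis by auto
qed

lemma normalizer_cyclic_all_permutations:
  assumes z: "primitive_root_of_unity 3 z"
  shows "normalizer PGL3 (generate PGL3 {pgl (diag_matrix (\<chi> i. z ^ triple 0 1 2 i))}) =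
    generate PGL3 (diagonal_subgroup \<union> S3_tilde)"
proof -
  let ?N = "normalizer PGL3 (generate PGL3 {pgl (diag_matrix (\<chi> i. z ^ triple 0 1 2 i))})"
  let ?m = "\<lambda>\<sigma>. pgl (monomial_matrix \<sigma> ones) :: ('a ^ 3 ^ 3) set"
  have N: "?N = {pgl (monomial_matrix \<sigma> u) | \<sigma> u. \<sigma> \<in> Collect bij \<and> (\<forall>i. u $ i \<noteq> 0)}"
    by (rule normalizer_cyclic_diag_3[OF z _ _ affine_exponent_permutations_mod_3]) simp_all
  have sub: "subgroup ?N PGL3" by (rule subgroup_normalizer_diag_3[OF z])
  show ?thesis
  proof (rule monomial_group_eq_generate[OF sub N])
    have "{\<lbrakk>\<X> : \<Z> : \<Y>\<rbrakk>, \<lbrakk>\<Z> : \<X> : \<Y>\<rbrakk>} \<subseteq> ?N"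
      unfolding N proj_map_perms by (force simp: bij_triple_iff)
    then show "S3_tilde \<subseteq> ?N"
      unfolding S3_tilde_def using PGL.generate_subgroup_incl sub by blast
  next
    fix \<sigma> :: "3 \<Rightarrow> 3" assume "\<sigma> \<in> Collect bij"
    then have "bij \<sigma>" by simp
    have mem: "?m (triple 1 3 2) \<in> S3_tilde" "?m (triple 3 1 2) \<in> S3_tilde"
      unfolding S3_tilde_def proj_map_perms by (auto intro: generate.incl)
    \<comment> \<open>Products compose permutations in reverse order. Each of the four permutations
      not among the generators is a product of two of them.\<close>
    have comp: "?m \<upsilon> \<in> S3_tilde"
      if "?m \<rho> \<in> S3_tilde" "?m \<tau> \<in> S3_tilde" "bij \<rho>" "bij \<tau>" "\<upsilon> = (\<lambda>i. \<tau> (\<rho> i))" for \<rho> \<tau> \<upsilon>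
      using that pgl_monomial_ones_mult[of \<rho> \<tau>] generate.eng
      unfolding S3_tilde_def by metis
    have bij: "bij (triple 1 3 2 :: 3 \<Rightarrow> 3)" "bij (triple 3 1 2 :: 3 \<Rightarrow> 3)"
      by (simp_all add: bij_triple_iff)
    have "?m (triple 1 2 3) \<in> S3_tilde"
      by (rule comp[OF mem(1) mem(1) bij(1) bij(1)]) (simp add: fun_eq_iff forall_3)
    moreover have "?m (triple 2 1 3) \<in> S3_tilde"
      by (rule comp[OF mem(2) mem(1) bij(2) bij(1)]) (simp add: fun_eq_iff forall_3)
    moreover have "?m (triple 2 3 1) \<in> S3_tilde"
      by (rule comp[OF mem(2) mem(2) bij(2) bij(2)]) (simp add: fun_eq_iff forall_3)
    moreover have "?m (triple 3 2 1) \<in> S3_tilde"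
      by (rule comp[OF mem(1) mem(2) bij(1) bij(2)]) (simp add: fun_eq_iff forall_3)
    ultimately have "?m \<sigma> \<in> S3_tilde"
      using mem bij_3_cases[OF \<open>bij \<sigma>\<close>] by blast
    then show "?m \<sigma> \<in> generate PGL3 (diagonal_subgroup \<union> S3_tilde)"
      by (intro generate.incl) simp
  qed (simp_all add: bij_id_fun)
qed

subsection \<open>Dihedral groups in the projective group of the plane\<close>

text \<open>One treatment for both dihedral subgroups: \<open>n = 3\<close> gives the symmetric
  group and \<open>n = 5\<close> the dihedral group of order 10.\<close>

locale dihedral_PGL3 =
  fixes z :: "'a::field" and n :: nat
  assumes prim: "primitive_root_of_unity n z" and odd_n: "odd n" and n_gt_1: "n > 1"
begin

text \<open>The exponent \<open>n - 1\<close> plays the role of -1 among the natural numbers, so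
  that exchanging the last two coordinates inverts the class.\<close>

definition rot :: "('a ^ 3 ^ 3) set" where
  "rot = pgl (diag_matrix (\<chi> i. z ^ triple 0 1 (n - 1) i))"

definition swap :: "('a ^ 3 ^ 3) set" where
  "swap = pgl (monomial_matrix (triple 1 3 2) ones)"

lemma z_nonzero: "z \<noteq> 0"
  using primitive_root_nonzero[OF prim] .

lemma z_power_n: "z * z ^ (n - 1) = 1"
proof -
  have "z * z ^ (n - 1) = z ^ n" using n_gt_1 power_Suc[of z "n - 1"] by simp
  then show ?thesis using prim by (simp add: primitive_root_of_unity_def)
qed

lemma z_power_inverse: "z ^ k * z ^ ((n - 1) * k) = 1"
proof -
  have "z ^ k * z ^ ((n - 1) * k) = (z * z ^ (n - 1)) ^ k"
    by (simp only: power_mult_distrib power_mult)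
  then show ?thesis by (simp only: z_power_n power_one)
qed

lemma bij_swap: "bij (triple 1 3 2 :: 3 \<Rightarrow> 3)"
  by (simp add: bij_triple_iff)

lemma swap_involutive: "triple 1 3 2 (triple 1 3 2 i) = (i :: 3)"
  using exhaust_3[of i] by auto

lemma ord_rot: "group.ord PGL3 rot = n"
  unfolding rot_def by (rule ord_diag_powers_3[OF prim]) simp

lemma rot_closed: "rot \<in> carrier PGL3"
  unfolding rot_def using z_nonzero by (intro pgl_closed invertible_diag_matrix) simp

lemma swap_closed: "swap \<in> carrier PGL3"
  unfolding swap_def by (intro pgl_closed invertible_monomial_matrix bij_swap) simp

lemma rot_pow: "rot [^]\<^bsub>PGL3\<^esub> (k::nat) = pgl (diag_matrix (\<chi> i. z ^ (triple 0 1 (n - 1) i * k)))"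
  unfolding rot_def using z_nonzero by (subst pgl_diag_matrix_pow) (simp_all add: power_mult)

lemma rot_pow_swap: "rot [^]\<^bsub>PGL3\<^esub> (k::nat) \<otimes>\<^bsub>PGL3\<^esub> swap =
    pgl (monomial_matrix (triple 1 3 2) (\<chi> i. z ^ (triple 0 1 (n - 1) i * k)))"
  unfolding rot_pow swap_def using z_nonzero
  by (subst pgl_monomial_mult) (simp_all add: bij_id_fun bij_swap)

sublocale D: dihedral_pair "PGL3 :: ('a ^ 3 ^ 3) set monoid" rot swap n
proof unfold_locales
  show "swap \<otimes>\<^bsub>PGL3\<^esub> swap = \<one>\<^bsub>PGL3\<^esub>"
    unfolding swap_def PGL_one diag_matrix_1[symmetric]
    by (simp add: pgl_monomial_ones_mult bij_swap swap_involutive)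
  \<comment> \<open>Multiplying once more by \<open>rot\<close> avoids inverting it: the exponents
    at \<open>i\<close> and at its image under the transposition add up to 0 or to
    \<open>n\<close>.\<close>
  have "swap \<otimes>\<^bsub>PGL3\<^esub> rot \<otimes>\<^bsub>PGL3\<^esub> swap \<otimes>\<^bsub>PGL3\<^esub> rot =
      pgl (diag_matrix (\<chi> i. z ^ triple 0 1 (n - 1) (triple 1 3 2 i) * z ^ triple 0 1 (n - 1) i))"
    unfolding rot_def swap_def
    using z_nonzero by (simp add: pgl_monomial_mult bij_id_fun bij_swap swap_involutive)
  also have "(\<chi> i. z ^ triple 0 1 (n - 1) (triple 1 3 2 i) * z ^ triple 0 1 (n - 1) i) = ones"
    using z_power_n by (simp add: vec_eq_iff forall_3 mult.commute)
  finally show "swap \<otimes>\<^bsub>PGL3\<^esub> rot \<otimes>\<^bsub>PGL3\<^esub> swap = inv\<^bsub>PGL3\<^esub> rot"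
    using swap_closed rot_closed
    by (intro PGL.inv_equality[symmetric]) (simp_all add: PGL_one diag_matrix_1)
  show "swap \<notin> generate PGL3 {rot}"
  proof
    \<comment> \<open>Powers of \<open>rot\<close> are diagonal, while the permutation of
      \<open>swap\<close> moves 2.\<close>
    assume "swap \<in> generate PGL3 {rot}"
    then obtain k :: nat where "swap = rot [^]\<^bsub>PGL3\<^esub> k"
      using PGL.generate_pow_nat[OF rot_closed] ord_rot n_gt_1 by auto
    then have "triple 1 3 2 = (\<lambda>i::3. i)"
      unfolding swap_def rot_pow by (simp add: pgl_monomial_eq_iff)
    then show False by (auto dest: fun_cong[of _ _ 2])
  qed
qed (use rot_closed swap_closed ord_rot n_gt_1 in auto)

text \<open>Only the monomial shape is retained from the cyclic case, since compatibility with
  \<open>swap\<close> will pin down the permutation.\<close>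

lemma normalizer_rot_subset:
  "normalizer PGL3 (generate PGL3 {rot}) \<subseteq>
     {pgl (monomial_matrix \<sigma> u) | \<sigma> u. bij \<sigma> \<and> (\<forall>i. u $ i \<noteq> 0)}"
proof -
  \<comment> \<open>Odd \<open>n\<close> excludes 2, the case in which the exponents 1 and -1
    coincide.\<close>
  have "1 mod n \<noteq> (n - 1) mod n" using odd_n n_gt_1 by (cases "n = 2") auto
  then have "inj (\<lambda>i. triple 0 1 (n - 1) i mod n)"
    using n_gt_1 by (auto simp: inj_def forall_3)
  moreover have "n dvd k" if "\<forall>i. n dvd triple 0 1 (n - 1) i * k" for k
    using spec[OF that, of 2] by simp
  ultimately have "normalizer PGL3 (generate PGL3 {rot}) =
      {pgl (monomial_matrix \<sigma> u) | \<sigma> u. bij \<sigma> \<and> (\<forall>i. u $ i \<noteq> 0) \<and>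
         (\<exists>k. \<forall>i. triple 0 1 (n - 1) (\<sigma> i) mod n =
            (triple 0 1 (n - 1) (\<sigma> 1) + triple 0 1 (n - 1) i * k) mod n)}"
    unfolding rot_def by (intro normalizer_cyclic_powers[OF prim] triple_simps)
  then show ?thesis by blast
qed

lemma subgroup_normalizer_dihedral: "subgroup (normalizer PGL3 (generate PGL3 {rot, swap})) PGL3"
  using rot_closed swap_closed by (intro PGL.normalizer_imp_subgroup PGL.generate_incl) simp

text \<open>Conjugating \<open>swap\<close> yields a class with some permutation
  \<open>\<tau>\<close>. Comparing permutations forces \<open>\<tau>\<close> to be the transposition
  and \<open>\<sigma>\<close> to commute with it, so \<open>\<sigma>\<close> fixes 1, the only fixed
  point of the transposition. Comparing entries leaves the condition on the ratio.\<close>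

lemma normalizer_dihedral:
  "normalizer PGL3 (generate PGL3 {rot, swap}) =
    {pgl (monomial_matrix \<sigma> u) | \<sigma> u. \<sigma> \<in> {\<lambda>i. i, triple 1 3 2} \<and> (\<forall>i. u $ i \<noteq> 0) \<and>
       (\<exists>k::nat. u $ 2 = z ^ k * u $ 3)}"
    (is "?N = ?R")
proof
  have gens: "{rot, swap} \<subseteq> carrier PGL3" using rot_closed swap_closed by simp
  note mem_N = PGL.mem_normalizer_generate_iff[OF gens D.finite_generate]
  show "?N \<subseteq> ?R"
  proof
    fix x assume x: "x \<in> ?N"
    then obtain \<sigma> u where \<sigma>u: "x = pgl (monomial_matrix \<sigma> u)" "bij \<sigma>" "\<And>i. u $ i \<noteq> 0"
      using D.normalizer_dihedral_subset_normalizer_cyclic[OF odd_n] normalizer_rot_subset by blast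
    have "x \<otimes>\<^bsub>PGL3\<^esub> swap \<otimes>\<^bsub>PGL3\<^esub> inv\<^bsub>PGL3\<^esub> x \<in> generate PGL3 {rot, swap}"
      using x unfolding mem_N by blast
    \<comment> \<open>The elements \<open>rot ^ k\<close> and \<open>rot ^ k * swap\<close> have the
      same nonzero entries and differ only in the permutation, so one formula covers both.\<close>
    then obtain \<tau> and k :: nat where \<tau>: "\<tau> = (\<lambda>i. i) \<or> \<tau> = triple 1 3 2"
      and conj: "x \<otimes>\<^bsub>PGL3\<^esub> swap \<otimes>\<^bsub>PGL3\<^esub> inv\<^bsub>PGL3\<^esub> x =
        pgl (monomial_matrix \<tau> (\<chi> i. z ^ (triple 0 1 (n - 1) i * k)))"
    proof (cases rule: D.mem_generate_cases)
      case (1 k)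
      then show ?thesis using that[of "\<lambda>i. i" k] by (simp only: rot_pow simp_thms)
    next
      case (2 k)
      then show ?thesis using that[of "triple 1 3 2" k] by (simp only: rot_pow_swap simp_thms)
    qed
    have "bij \<tau>" using \<tau> bij_id_fun bij_swap by blast
    have "pgl (monomial_matrix \<sigma> u ** monomial_matrix (triple 1 3 2) ones) =
        pgl (monomial_matrix \<tau> (\<chi> i. z ^ (triple 0 1 (n - 1) i * k)) ** monomial_matrix \<sigma> u)"
      using conj unfolding \<sigma>u(1) swap_def
      by (subst (asm) PGL_conj_eq_iff)
        (use \<sigma>u(2,3) \<open>bij \<tau>\<close> bij_swap z_nonzero in \<open>auto intro!: invertible_monomial_matrix\<close>)
    then have comm: "(\<lambda>i. triple 1 3 2 (\<sigma> i)) = (\<lambda>i. \<sigma> (\<tau> i))"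
      and "\<exists>c. c \<noteq> 0 \<and> (\<forall>i. u $ i = c * (z ^ (triple 0 1 (n - 1) i * k) * u $ \<tau> i))"
      using \<sigma>u(3) unfolding monomial_matrix_mult by (simp_all add: pgl_monomial_eq_iff)
    then obtain c where c: "\<And>i. u $ i = c * (z ^ (triple 0 1 (n - 1) i * k) * u $ \<tau> i)" by blast
    have comm_at: "triple 1 3 2 (\<sigma> i) = \<sigma> (\<tau> i)" for i using fun_cong[OF comm] .
    \<comment> \<open>Otherwise the transposition would fix every value of \<open>\<sigma>\<close>,
      including the value 2, which is attained.\<close>
    have "\<tau> \<noteq> (\<lambda>i. i)"
    proof
      assume "\<tau> = (\<lambda>i. i)"
      then have "triple 1 3 2 (\<sigma> (inv' \<sigma> 2)) = \<sigma> (inv' \<sigma> 2)" using comm_at by metis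
      then show False using \<sigma>u(2) by (simp add: bij_is_surj surj_f_inv_f)
    qed
    then have \<tau>_eq: "\<tau> = triple 1 3 2" using \<tau> by blast
    have "triple 1 3 2 (\<sigma> 1) = \<sigma> 1" using comm_at[of 1] \<tau>_eq by simp
    then have "\<sigma> = triple 1 2 3 \<or> \<sigma> = triple 1 3 2"
      using bij_3_cases[OF \<sigma>u(2)] by (elim disjE) auto
    then have "\<sigma> \<in> {\<lambda>i. i, triple 1 3 2}" by (simp add: triple_id)
    \<comment> \<open>The first coordinate is fixed by \<open>\<tau>\<close> and has exponent 0, so
      it exposes the projective scalar; the second then gives the ratio.\<close>
    moreover have "c = 1" using c[of 1] \<tau>_eq \<sigma>u(3)[of 1] by simp
    then have "u $ 2 = z ^ k * u $ 3" using c[of 2] \<tau>_eq by simp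
    ultimately show "x \<in> ?R" using \<sigma>u by blast
  qed
  have H: "subgroup (generate PGL3 {rot, swap}) PGL3" using PGL.generate_is_subgroup[OF gens] .
  have in_H: "rot \<in> generate PGL3 {rot, swap}" "swap \<in> generate PGL3 {rot, swap}"
    by (auto intro: generate.incl)
  have diag_N: "pgl (diag_matrix v) \<in> ?N" if v: "\<And>i. v $ i \<noteq> 0" and k: "v $ 2 = z ^ k * v $ 3"
    for v :: "'a ^ 3" and k :: nat
  proof -
    have inv: "invertible (diag_matrix v)" using v by (rule invertible_diag_matrix)
    have "pgl (diag_matrix v) \<otimes>\<^bsub>PGL3\<^esub> rot \<otimes>\<^bsub>PGL3\<^esub> inv\<^bsub>PGL3\<^esub> pgl (diag_matrix v) = rot"
      unfolding rot_def
      by (subst PGL_conj_eq_iff[OF inv])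
        (use z_nonzero in \<open>auto simp: monomial_matrix_mult mult.commute intro!: invertible_diag_matrix\<close>)
    \<comment> \<open>Conjugation by \<open>diag v\<close> multiplies row 2 of the transposition
      matrix by \<open>v 2 / v 3 = z ^ k\<close> and row 3 by the inverse, which is the power of
      \<open>z\<close> with exponent \<open>(n - 1) * k\<close>.\<close>
    moreover have "pgl (diag_matrix v) \<otimes>\<^bsub>PGL3\<^esub> swap \<otimes>\<^bsub>PGL3\<^esub> inv\<^bsub>PGL3\<^esub> pgl (diag_matrix v) =
        rot [^]\<^bsub>PGL3\<^esub> k \<otimes>\<^bsub>PGL3\<^esub> swap"
    proof -
      have "z ^ ((n - 1) * k) * v $ 2 = (z ^ k * z ^ ((n - 1) * k)) * v $ 3"
        unfolding k by (simp only: mult_ac)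
      then have "z ^ ((n - 1) * k) * v $ 2 = v $ 3" by (simp only: z_power_inverse mult_1)
      then have "\<forall>i. z ^ (triple 0 1 (n - 1) i * k) * v $ triple 1 3 2 i = v $ i"
        unfolding forall_3 using k by simp
      then have eq: "(\<chi> i. z ^ (triple 0 1 (n - 1) i * k) * v $ triple 1 3 2 i) = v"
        by (simp only: vec_eq_iff vec_lambda_beta simp_thms)
      have "pgl (diag_matrix v ** monomial_matrix (triple 1 3 2) ones) =
          pgl (monomial_matrix (triple 1 3 2) (\<chi> i. z ^ (triple 0 1 (n - 1) i * k)) ** diag_matrix v)"
        unfolding monomial_matrix_mult
        by (simp only: vec_lambda_beta mult_1_right vec_lambda_eta eq)
      then show ?thesis
        unfolding rot_pow_swap unfolding swap_def
        by (subst PGL_conj_eq_iff[OF inv])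
          (use z_nonzero bij_swap in \<open>auto intro!: invertible_monomial_matrix\<close>)
    qed
    moreover have "rot [^]\<^bsub>PGL3\<^esub> k \<otimes>\<^bsub>PGL3\<^esub> swap \<in> generate PGL3 {rot, swap}"
      using in_H PGL.subgroup_int_pow_closed[OF H in_H(1), of "int k"]
      by (intro subgroup.m_closed[OF H]) (simp_all add: int_pow_int)
    ultimately show ?thesis
      unfolding mem_N using in_H pgl_closed[OF inv] by simp
  qed
  have swap_N: "swap \<in> ?N"
    unfolding mem_N using in_H H swap_closed
    by (auto intro!: subgroup.m_closed[OF H] subgroup.m_inv_closed[OF H])
  show "?R \<subseteq> ?N"
  proof
    fix x assume "x \<in> ?R"
    then obtain \<sigma> u and k :: nat where x: "x = pgl (monomial_matrix \<sigma> u)" "\<And>i. u $ i \<noteq> 0"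
      "u $ 2 = z ^ k * u $ 3" and \<sigma>: "\<sigma> = (\<lambda>i. i) \<or> \<sigma> = triple 1 3 2" by blast
    have "pgl (diag_matrix u) \<otimes>\<^bsub>PGL3\<^esub> swap \<in> ?N"
      using diag_N[OF x(2,3)] swap_N subgroup_normalizer_dihedral by (meson subgroup.m_closed)
    then have "pgl (monomial_matrix (triple 1 3 2) u) \<in> ?N"
      unfolding pgl_monomial_decomp[OF bij_swap x(2)] swap_def .
    then show "x \<in> ?N" using \<sigma> x(1) diag_N[OF x(2,3)] by blast
  qed
qed

text \<open>Up to the scalar \<open>u 3\<close>, a diagonal class in the normalizer is
  \<open>diag (u 1 / u 3, 1, 1)\<close> times \<open>diag (1, z ^ k, 1)\<close>. The first factor
  lies in \<open>T_X\<close>, so a generating set only has to supply the second factor and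
  \<open>swap\<close>.\<close>

lemma normalizer_dihedral_eq_generate:
  assumes T: "T_X \<subseteq> generate PGL3 A" and swap: "swap \<in> generate PGL3 A"
    and A: "A \<subseteq> normalizer PGL3 (generate PGL3 {rot, swap})"
    and d: "\<And>k::nat. pgl (diag_matrix (vector [1, z ^ k, 1])) \<in> generate PGL3 A"
  shows "normalizer PGL3 (generate PGL3 {rot, swap}) = generate PGL3 A"
proof
  show "generate PGL3 A \<subseteq> normalizer PGL3 (generate PGL3 {rot, swap})"
    by (rule PGL.generate_subgroup_incl[OF A subgroup_normalizer_dihedral])
  show "normalizer PGL3 (generate PGL3 {rot, swap}) \<subseteq> generate PGL3 A"
  proof
    fix x assume "x \<in> normalizer PGL3 (generate PGL3 {rot, swap})"
    then obtain \<sigma> u and k :: nat where x: "x = pgl (monomial_matrix \<sigma> u)" "\<And>i. u $ i \<noteq> 0"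
      "u $ 2 = z ^ k * u $ 3" and \<sigma>: "\<sigma> = (\<lambda>i. i) \<or> \<sigma> = triple 1 3 2"
      unfolding normalizer_dihedral by blast
    let ?a = "u $ 1 / u $ 3"
    have nz: "(vector [?a, 1, 1] :: 'a ^ 3) $ i \<noteq> 0" "(vector [1, z ^ k, 1] :: 'a ^ 3) $ i \<noteq> 0" for i
      using exhaust_3[of i] x(2) z_nonzero by auto
    have "pgl (diag_matrix u) =
        pgl (diag_matrix (\<chi> i. (vector [?a, 1, 1] :: 'a ^ 3) $ i * (vector [1, z ^ k, 1] :: 'a ^ 3) $ i))"
      unfolding pgl_diag_matrix_eq_iff using x(2,3)
      by (intro exI[of _ "u $ 3"]) (simp add: forall_3)
    also have "\<dots> = pgl (diag_matrix (vector [?a, 1, 1])) \<otimes>\<^bsub>PGL3\<^esub> pgl (diag_matrix (vector [1, z ^ k, 1]))"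
      by (subst pgl_monomial_mult) (use nz bij_id_fun in auto)
    also have "\<dots> \<in> generate PGL3 A"
    proof (rule generate.eng[OF _ d])
      have "pgl (diag_matrix (vector [?a, 1, 1])) \<in> T_X"
        unfolding T_X_eq using x(2) by fastforce
      then show "pgl (diag_matrix (vector [?a, 1, 1])) \<in> generate PGL3 A" using T by blast
    qed
    finally have diag: "pgl (diag_matrix u) \<in> generate PGL3 A" .
    then have "pgl (monomial_matrix (triple 1 3 2) u) \<in> generate PGL3 A"
      unfolding pgl_monomial_decomp[OF bij_swap x(2)]
      using swap unfolding swap_def by (rule generate.eng)
    then show "x \<in> generate PGL3 A" using \<sigma> x(1) diag by blast
  qed
qed

lemma T_X_subset_normalizer: "T_X \<subseteq> normalizer PGL3 (generate PGL3 {rot, swap})"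
proof
  fix x assume "x \<in> (T_X :: ('a ^ 3 ^ 3) set set)"
  then obtain a where a: "a \<noteq> 0" "x = pgl (diag_matrix (vector [a, 1, 1]))" by (auto simp: T_X_eq)
  have "\<exists>k::nat. (vector [a, 1, 1] :: 'a ^ 3) $ 2 = z ^ k * (vector [a, 1, 1] :: 'a ^ 3) $ 3"
    by (rule exI[of _ 0]) simp
  moreover have "\<forall>i. (vector [a, 1, 1] :: 'a ^ 3) $ i \<noteq> 0" using a by (simp add: forall_3)
  ultimately show "x \<in> normalizer PGL3 (generate PGL3 {rot, swap})"
    unfolding normalizer_dihedral a(2) by blast
qed

lemma swap_in_normalizer: "swap \<in> normalizer PGL3 (generate PGL3 {rot, swap})"
proof -
  have "\<exists>k::nat. (ones :: 'a ^ 3) $ 2 = z ^ k * (ones :: 'a ^ 3) $ 3" by (rule exI[of _ 0]) simp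
  moreover have "\<forall>i. (ones :: 'a ^ 3) $ i \<noteq> 0" by simp
  ultimately show ?thesis unfolding normalizer_dihedral unfolding swap_def by blast
qed

lemma diag_pow_in_generate:
  assumes "pgl (diag_matrix v) \<in> generate PGL3 A" "A \<subseteq> carrier PGL3" "\<And>i. v $ i \<noteq> 0"
  shows "pgl (diag_matrix (\<chi> i. v $ i ^ k)) \<in> generate PGL3 A"
  using PGL.subgroup_int_pow_closed[OF PGL.generate_is_subgroup[OF assms(2)] assms(1), of "int k"]
  unfolding int_pow_int pgl_diag_matrix_pow[OF assms(3)] .

lemma normalizer_dihedral_Y:
  "normalizer PGL3 (generate PGL3 {rot, swap}) =
     generate PGL3 (T_X \<union> generate PGL3 {swap, \<lbrakk>\<X> : z *s \<Y> : \<Z>\<rbrakk>})"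
proof -
  let ?N = "normalizer PGL3 (generate PGL3 {rot, swap})"
  let ?v = "vector [1, z, 1] :: 'a ^ 3"
  let ?G = "generate PGL3 {swap, \<lbrakk>\<X> : z *s \<Y> : \<Z>\<rbrakk>}"
  have Y: "\<lbrakk>\<X> : z *s \<Y> : \<Z>\<rbrakk> = pgl (diag_matrix ?v)" using proj_map_diag[of 1 z 1] by simp
  have v: "?v $ i \<noteq> 0" for i using exhaust_3[of i] z_nonzero by auto
  have "?v $ 2 = z ^ 1 * ?v $ 3" by simp
  then have Y_N: "\<lbrakk>\<X> : z *s \<Y> : \<Z>\<rbrakk> \<in> ?N" unfolding Y normalizer_dihedral using v by blast
  have G: "?G \<subseteq> ?N"
    using PGL.generate_subgroup_incl[OF _ subgroup_normalizer_dihedral] Y_N swap_in_normalizer by simp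
  have G_mem: "x \<in> generate PGL3 (T_X \<union> ?G)" if "x \<in> T_X \<union> ?G" for x
    using that by (rule generate.incl)
  show ?thesis
  proof (rule normalizer_dihedral_eq_generate)
    show A: "T_X \<union> ?G \<subseteq> ?N" using T_X_subset_normalizer G by blast
    show "T_X \<subseteq> generate PGL3 (T_X \<union> ?G)" using G_mem by blast
    show "swap \<in> generate PGL3 (T_X \<union> ?G)" by (rule G_mem) (simp add: generate.incl)
    fix k :: nat
    have "pgl (diag_matrix ?v) \<in> generate PGL3 (T_X \<union> ?G)"
      unfolding Y[symmetric] by (rule G_mem) (simp add: generate.incl)
    moreover have "T_X \<union> ?G \<subseteq> carrier PGL3" using A PGL.normalizer_subset_carrier by blast
    ultimately have "pgl (diag_matrix (\<chi> i. ?v $ i ^ k)) \<in> generate PGL3 (T_X \<union> ?G)"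
      using diag_pow_in_generate v by blast
    moreover have "(\<chi> i. ?v $ i ^ k) = vector [1, z ^ k, 1]" by (simp add: vec_eq_iff forall_3)
    ultimately show "pgl (diag_matrix (vector [1, z ^ k, 1])) \<in> generate PGL3 (T_X \<union> ?G)" by simp
  qed
qed

text \<open>Scaling Z instead of Y changes nothing modulo \<open>T_X\<close>:
  \<open>diag (w, 1, w)\<close> and \<open>diag (1, 1 / w, 1)\<close> are the same class.\<close>

lemma normalizer_dihedral_Z:
  "normalizer PGL3 (generate PGL3 {rot, swap}) =
     generate PGL3 (T_X \<union> generate PGL3 {swap, \<lbrakk>\<X> : \<Y> : z *s \<Z>\<rbrakk>})"
proof -
  let ?N = "normalizer PGL3 (generate PGL3 {rot, swap})"
  let ?v = "vector [1, 1, z] :: 'a ^ 3"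
  let ?G = "generate PGL3 {swap, \<lbrakk>\<X> : \<Y> : z *s \<Z>\<rbrakk>}"
  have Z: "\<lbrakk>\<X> : \<Y> : z *s \<Z>\<rbrakk> = pgl (diag_matrix ?v)" using proj_map_diag[of 1 1 z] by simp
  have v: "?v $ i \<noteq> 0" for i using exhaust_3[of i] z_nonzero by auto
  \<comment> \<open>The ratio of the last two entries is the inverse of \<open>z\<close>, that is,
    its power with exponent \<open>n - 1\<close>.\<close>
  have "?v $ 2 = z ^ (n - 1) * ?v $ 3" using z_power_n by (simp add: mult.commute)
  then have Z_N: "\<lbrakk>\<X> : \<Y> : z *s \<Z>\<rbrakk> \<in> ?N" unfolding Z normalizer_dihedral using v by blast
  have G: "?G \<subseteq> ?N"
    using PGL.generate_subgroup_incl[OF _ subgroup_normalizer_dihedral] Z_N swap_in_normalizer by simp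
  have G_mem: "x \<in> generate PGL3 (T_X \<union> ?G)" if "x \<in> T_X \<union> ?G" for x
    using that by (rule generate.incl)
  show ?thesis
  proof (rule normalizer_dihedral_eq_generate)
    show A: "T_X \<union> ?G \<subseteq> ?N" using T_X_subset_normalizer G by blast
    show "T_X \<subseteq> generate PGL3 (T_X \<union> ?G)" using G_mem by blast
    show "swap \<in> generate PGL3 (T_X \<union> ?G)" by (rule G_mem) (simp add: generate.incl)
    fix k :: nat
    \<comment> \<open>The exponent \<open>m\<close> represents \<open>- k\<close> modulo
      \<open>n\<close>, so that dividing by \<open>z ^ m\<close> leaves \<open>z ^ k\<close> in the
      middle.\<close>
    define m where "m = (n - 1) * k"
    have zm: "z ^ m * z ^ k = 1"
      using z_power_inverse[of k] by (simp only: m_def mult.commute)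
    have "pgl (diag_matrix ?v) \<in> generate PGL3 (T_X \<union> ?G)"
      unfolding Z[symmetric] by (rule G_mem) (simp add: generate.incl)
    moreover have "T_X \<union> ?G \<subseteq> carrier PGL3" using A PGL.normalizer_subset_carrier by blast
    ultimately have "pgl (diag_matrix (\<chi> i. ?v $ i ^ m)) \<in> generate PGL3 (T_X \<union> ?G)"
      using diag_pow_in_generate v by blast
    moreover have "pgl (diag_matrix (vector [z ^ m, 1, 1])) \<in> generate PGL3 (T_X \<union> ?G)"
      using z_nonzero by (intro G_mem) (auto simp: T_X_eq)
    ultimately have "pgl (diag_matrix (vector [z ^ m, 1, 1])) \<otimes>\<^bsub>PGL3\<^esub> pgl (diag_matrix (\<chi> i. ?v $ i ^ m))
        \<in> generate PGL3 (T_X \<union> ?G)"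
      by (intro generate.eng)
    also have "pgl (diag_matrix (vector [z ^ m, 1, 1])) \<otimes>\<^bsub>PGL3\<^esub> pgl (diag_matrix (\<chi> i. ?v $ i ^ m)) =
        pgl (diag_matrix (\<chi> i. (vector [z ^ m, 1, 1] :: 'a ^ 3) $ i * ?v $ i ^ m))"
    proof -
      have "(vector [z ^ m, 1, 1] :: 'a ^ 3) $ i \<noteq> 0" for i
        using exhaust_3[of i] z_nonzero by auto
      then show ?thesis using v by (subst pgl_monomial_mult) (simp_all add: bij_id_fun)
    qed
    also have "\<dots> = pgl (diag_matrix (vector [1, z ^ k, 1]))"
      unfolding pgl_diag_matrix_eq_iff using zm z_nonzero
      by (intro exI[of _ "z ^ m"]) (simp add: forall_3)
    finally show "pgl (diag_matrix (vector [1, z ^ k, 1])) \<in> generate PGL3 (T_X \<union> ?G)" .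
  qed
qed

lemma rot_swap_eq_proj_map:
  "{rot, swap} = {\<lbrakk>\<X> : z *s \<Y> : z ^ (n - 1) *s \<Z>\<rbrakk>, \<lbrakk>\<X> : \<Z> : \<Y>\<rbrakk>}"
  using proj_map_diag_powers[of z 1 "n - 1"] by (simp add: rot_def swap_def proj_map_perms)

end

theorem theorem3p1:
  fixes \<iota> :: "'k::field \<Rightarrow> 'a::field"
    and \<zeta> :: "nat \<Rightarrow> 'a"
  assumes "CHAR('k) = 0 \<or> CHAR('k) > 13"
    and "separable_closure \<iota>"
    and "\<And>n. n \<in> {3, 4, 5, 8, 10} \<Longrightarrow> primitive_root_of_unity n (\<zeta> n)"
  shows
    "normalizer (PGL3 :: ('a ^ 3 ^ 3) set monoid) {\<one>\<^bsub>PGL3\<^esub>} = carrier PGL3 \<and>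
     (let H = generate PGL3 {\<lbrakk>\<X> : \<Y> : - (\<Z> :: 'a ^ 3)\<rbrakk>} in
        PGL3\<lparr>carrier := H\<rparr> \<cong> integer_mod_group 2 \<and>
        normalizer PGL3 H = GL2_Z) \<and>
     (let H = generate PGL3 {\<lbrakk>\<X> : \<zeta> 3 *s \<Y> : (\<zeta> 3)\<^sup>2 *s \<Z>\<rbrakk>} in
        PGL3\<lparr>carrier := H\<rparr> \<cong> integer_mod_group 3 \<and>
        normalizer PGL3 H = generate PGL3 (diagonal_subgroup \<union> S3_tilde)) \<and>
     (let H = generate PGL3 {\<lbrakk>\<X> : \<Y> : \<zeta> 4 *s \<Z>\<rbrakk>} in
        PGL3\<lparr>carrier := H\<rparr> \<cong> integer_mod_group 4 \<and>
        normalizer PGL3 H = GL2_Z) \<and>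
     (let H = generate PGL3 {\<lbrakk>\<X> : \<zeta> 4 *s \<Y> : (\<zeta> 4)\<^sup>2 *s \<Z>\<rbrakk>} in
        PGL3\<lparr>carrier := H\<rparr> \<cong> integer_mod_group 4 \<and>
        normalizer PGL3 H = generate PGL3 (diagonal_subgroup \<union> {\<lbrakk>\<Z> : \<Y> : \<X>\<rbrakk>})) \<and>
     (let H = generate PGL3 {\<lbrakk>\<X> : \<Y> : \<zeta> 5 *s \<Z>\<rbrakk>} in
        PGL3\<lparr>carrier := H\<rparr> \<cong> integer_mod_group 5 \<and>
        normalizer PGL3 H = GL2_Z) \<and>
     (let H = generate PGL3 {\<lbrakk>\<X> : \<zeta> 3 *s \<Y> : (\<zeta> 3)\<^sup>2 *s \<Z>\<rbrakk>, \<lbrakk>\<X> : \<Z> : \<Y>\<rbrakk>} in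
        PGL3\<lparr>carrier := H\<rparr> \<cong> sym_group 3 \<and>
        normalizer PGL3 H = generate PGL3 (T_X \<union> G03 (\<zeta> 3))) \<and>
     (let H = generate PGL3 {\<lbrakk>\<X> : \<zeta> 8 *s \<Y> : \<zeta> 8 ^ 4 *s \<Z>\<rbrakk>} in
        PGL3\<lparr>carrier := H\<rparr> \<cong> integer_mod_group 8 \<and>
        normalizer PGL3 H = generate PGL3 (diagonal_subgroup \<union> {\<lbrakk>\<Z> : \<Y> : \<X>\<rbrakk>})) \<and>
     (let H = generate PGL3 {\<lbrakk>\<X> : \<zeta> 5 *s \<Y> : \<zeta> 5 ^ 4 *s \<Z>\<rbrakk>, \<lbrakk>\<X> : \<Z> : \<Y>\<rbrakk>} in
        PGL3\<lparr>carrier := H\<rparr> \<cong> dihedral_group 5 \<and>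
        normalizer PGL3 H = generate PGL3 (T_X \<union> G05 (\<zeta> 5))) \<and>
     (let H = generate PGL3 {\<lbrakk>\<X> : (\<zeta> 10)\<^sup>2 *s \<Y> : \<zeta> 10 ^ 5 *s \<Z>\<rbrakk>} in
        PGL3\<lparr>carrier := H\<rparr> \<cong> integer_mod_group 10 \<and>
        normalizer PGL3 H = diagonal_subgroup)"
proof -
  have p3: "primitive_root_of_unity 3 (\<zeta> 3)" and p4: "primitive_root_of_unity 4 (\<zeta> 4)"
    and p5: "primitive_root_of_unity 5 (\<zeta> 5)" and p8: "primitive_root_of_unity 8 (\<zeta> 8)"
    and p10: "primitive_root_of_unity 10 (\<zeta> 10)"
    using assms(3) by simp_all
  have p2: "primitive_root_of_unity 2 (- 1 :: 'a)"
    using primitive_root_minus_1[OF primitive_root_4_imp_minus_1_neq_1[OF p4]] .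
  \<comment> \<open>The subgroups of order 2, 4 and 5 generated by a scaling of Z are treated at
    once, with -1 as the root of unity for order 2.\<close>
  have homology_iso: "PGL3\<lparr>carrier := generate PGL3 {\<lbrakk>\<X> : \<Y> : z *s \<Z>\<rbrakk>}\<rparr> \<cong> integer_mod_group n"
    and homology_normalizer: "normalizer PGL3 (generate PGL3 {\<lbrakk>\<X> : \<Y> : z *s \<Z>\<rbrakk>}) = GL2_Z"
    if "primitive_root_of_unity n z" "n > 1" for n and z :: 'a
    using cyclic_diag_3_iso[OF that(1), of 0 1] normalizer_homology[OF that]
      proj_map_diag_powers[of z 0 1] by simp_all
  interpret D3: dihedral_PGL3 "\<zeta> 3" 3 by unfold_locales (use p3 in auto)
  interpret D5: dihedral_PGL3 "\<zeta> 5" 5 by unfold_locales (use p5 in auto)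
  show ?thesis
    unfolding Let_def
  proof (intro conjI)
    show "normalizer (PGL3 :: ('a ^ 3 ^ 3) set monoid) {\<one>\<^bsub>PGL3\<^esub>} = carrier PGL3"
      by (auto simp: PGL.mem_normalizer_iff)
    have neg: "- \<Z> = (- 1 :: 'a) *s \<Z>" by (rule vector_sneg_minus1)
    show "PGL3\<lparr>carrier := generate PGL3 {\<lbrakk>\<X> : \<Y> : - (\<Z> :: 'a ^ 3)\<rbrakk>}\<rparr> \<cong> integer_mod_group 2"
      "normalizer PGL3 (generate PGL3 {\<lbrakk>\<X> : \<Y> : - (\<Z> :: 'a ^ 3)\<rbrakk>}) = GL2_Z"
      unfolding neg by (rule homology_iso[OF p2] homology_normalizer[OF p2], simp)+
    show "PGL3\<lparr>carrier := generate PGL3 {\<lbrakk>\<X> : \<Y> : \<zeta> 4 *s \<Z>\<rbrakk>}\<rparr> \<cong> integer_mod_group 4"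
      "normalizer PGL3 (generate PGL3 {\<lbrakk>\<X> : \<Y> : \<zeta> 4 *s \<Z>\<rbrakk>}) = GL2_Z"
      by (simp_all add: homology_iso[OF p4] homology_normalizer[OF p4])
    show "PGL3\<lparr>carrier := generate PGL3 {\<lbrakk>\<X> : \<Y> : \<zeta> 5 *s \<Z>\<rbrakk>}\<rparr> \<cong> integer_mod_group 5"
      "normalizer PGL3 (generate PGL3 {\<lbrakk>\<X> : \<Y> : \<zeta> 5 *s \<Z>\<rbrakk>}) = GL2_Z"
      by (simp_all add: homology_iso[OF p5] homology_normalizer[OF p5])
    have g3: "\<lbrakk>\<X> : \<zeta> 3 *s \<Y> : (\<zeta> 3)\<^sup>2 *s \<Z>\<rbrakk> = pgl (diag_matrix (\<chi> i. \<zeta> 3 ^ triple 0 1 2 i))"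
      using proj_map_diag_powers[of "\<zeta> 3" 1 2] by simp
    show "PGL3\<lparr>carrier := generate PGL3 {\<lbrakk>\<X> : \<zeta> 3 *s \<Y> : (\<zeta> 3)\<^sup>2 *s \<Z>\<rbrakk>}\<rparr> \<cong> integer_mod_group 3"
      unfolding g3 by (rule cyclic_diag_3_iso[OF p3]) simp
    show "normalizer PGL3 (generate PGL3 {\<lbrakk>\<X> : \<zeta> 3 *s \<Y> : (\<zeta> 3)\<^sup>2 *s \<Z>\<rbrakk>}) =
        generate PGL3 (diagonal_subgroup \<union> S3_tilde)"
      unfolding g3 by (rule normalizer_cyclic_all_permutations[OF p3])
    have g4: "\<lbrakk>\<X> : \<zeta> 4 *s \<Y> : (\<zeta> 4)\<^sup>2 *s \<Z>\<rbrakk> = pgl (diag_matrix (\<chi> i. \<zeta> 4 ^ triple 0 1 2 i))"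
      using proj_map_diag_powers[of "\<zeta> 4" 1 2] by simp
    show "PGL3\<lparr>carrier := generate PGL3 {\<lbrakk>\<X> : \<zeta> 4 *s \<Y> : (\<zeta> 4)\<^sup>2 *s \<Z>\<rbrakk>}\<rparr> \<cong> integer_mod_group 4"
      unfolding g4 by (rule cyclic_diag_3_iso[OF p4]) simp
    show "normalizer PGL3 (generate PGL3 {\<lbrakk>\<X> : \<zeta> 4 *s \<Y> : (\<zeta> 4)\<^sup>2 *s \<Z>\<rbrakk>}) =
        generate PGL3 (diagonal_subgroup \<union> {\<lbrakk>\<Z> : \<Y> : \<X>\<rbrakk>})"
      unfolding g4 by (rule normalizer_cyclic_reversal[OF p4 _ _ affine_exponent_permutations_mod_4]) simp_all
    have g8: "\<lbrakk>\<X> : \<zeta> 8 *s \<Y> : \<zeta> 8 ^ 4 *s \<Z>\<rbrakk> = pgl (diag_matrix (\<chi> i. \<zeta> 8 ^ triple 0 1 4 i))"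
      using proj_map_diag_powers[of "\<zeta> 8" 1 4] by simp
    show "PGL3\<lparr>carrier := generate PGL3 {\<lbrakk>\<X> : \<zeta> 8 *s \<Y> : \<zeta> 8 ^ 4 *s \<Z>\<rbrakk>}\<rparr> \<cong> integer_mod_group 8"
      unfolding g8 by (rule cyclic_diag_3_iso[OF p8]) simp
    show "normalizer PGL3 (generate PGL3 {\<lbrakk>\<X> : \<zeta> 8 *s \<Y> : \<zeta> 8 ^ 4 *s \<Z>\<rbrakk>}) =
        generate PGL3 (diagonal_subgroup \<union> {\<lbrakk>\<Z> : \<Y> : \<X>\<rbrakk>})"
      unfolding g8 by (rule normalizer_cyclic_reversal[OF p8 _ _ affine_exponent_permutations_mod_8]) simp_all
    have g10: "\<lbrakk>\<X> : (\<zeta> 10)\<^sup>2 *s \<Y> : \<zeta> 10 ^ 5 *s \<Z>\<rbrakk> = pgl (diag_matrix (\<chi> i. \<zeta> 10 ^ triple 0 2 5 i))"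
      by (rule proj_map_diag_powers)
    \<comment> \<open>Neither 2 nor 5 is a unit modulo 10, but divisibility of \<open>2 * k\<close>
      gives the factor 5 and that of \<open>5 * k\<close> the factor 2.\<close>
    have gen10: "\<forall>k. 10 dvd 2 * k \<longrightarrow> 10 dvd 5 * k \<longrightarrow> 10 dvd (k::nat)" by presburger
    show "PGL3\<lparr>carrier := generate PGL3 {\<lbrakk>\<X> : (\<zeta> 10)\<^sup>2 *s \<Y> : \<zeta> 10 ^ 5 *s \<Z>\<rbrakk>}\<rparr> \<cong> integer_mod_group 10"
      unfolding g10 by (rule cyclic_diag_3_iso[OF p10 gen10])
    show "normalizer PGL3 (generate PGL3 {\<lbrakk>\<X> : (\<zeta> 10)\<^sup>2 *s \<Y> : \<zeta> 10 ^ 5 *s \<Z>\<rbrakk>}) = diagonal_subgroup"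
      unfolding g10 by (rule normalizer_cyclic_identity[OF p10 gen10 _ affine_exponent_permutations_mod_10]) simp
    have H3: "{\<lbrakk>\<X> : \<zeta> 3 *s \<Y> : (\<zeta> 3)\<^sup>2 *s \<Z>\<rbrakk>, \<lbrakk>\<X> : \<Z> : \<Y>\<rbrakk>} = {D3.rot, D3.swap}"
      unfolding D3.rot_swap_eq_proj_map by simp
    show "PGL3\<lparr>carrier := generate PGL3 {\<lbrakk>\<X> : \<zeta> 3 *s \<Y> : (\<zeta> 3)\<^sup>2 *s \<Z>\<rbrakk>, \<lbrakk>\<X> : \<Z> : \<Y>\<rbrakk>}\<rparr> \<cong> sym_group 3"
      unfolding H3 by (rule iso_trans[OF D3.D.generate_iso_dihedral_group dihedral_group_3_iso_sym_group])
    show "normalizer PGL3 (generate PGL3 {\<lbrakk>\<X> : \<zeta> 3 *s \<Y> : (\<zeta> 3)\<^sup>2 *s \<Z>\<rbrakk>, \<lbrakk>\<X> : \<Z> : \<Y>\<rbrakk>}) =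
        generate PGL3 (T_X \<union> G03 (\<zeta> 3))"
      unfolding H3 D3.normalizer_dihedral_Y unfolding G03_def D3.swap_def proj_map_perms ..
    have H5: "{\<lbrakk>\<X> : \<zeta> 5 *s \<Y> : \<zeta> 5 ^ 4 *s \<Z>\<rbrakk>, \<lbrakk>\<X> : \<Z> : \<Y>\<rbrakk>} = {D5.rot, D5.swap}"
      unfolding D5.rot_swap_eq_proj_map by simp
    show "PGL3\<lparr>carrier := generate PGL3 {\<lbrakk>\<X> : \<zeta> 5 *s \<Y> : \<zeta> 5 ^ 4 *s \<Z>\<rbrakk>, \<lbrakk>\<X> : \<Z> : \<Y>\<rbrakk>}\<rparr> \<cong> dihedral_group 5"
      unfolding H5 by (rule D5.D.generate_iso_dihedral_group)
    show "normalizer PGL3 (generate PGL3 {\<lbrakk>\<X> : \<zeta> 5 *s \<Y> : \<zeta> 5 ^ 4 *s \<Z>\<rbrakk>, \<lbrakk>\<X> : \<Z> : \<Y>\<rbrakk>}) =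
        generate PGL3 (T_X \<union> G05 (\<zeta> 5))"
      unfolding H5 D5.normalizer_dihedral_Z unfolding G05_def D5.swap_def proj_map_perms ..
  qed
qed

end
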